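(* Let $V$ be a finite-dimensional real vector space, $\mathcal{O}\subset V$ open, and $\pi$ any bivector field on $\mathcal{O}$. Let $\phi\in\Omega^1(V^*;C^\infty(\mathcal{O}))$ be a solution of \[ (\mathrm{MC}_\phi)_\xi(\xi,\zeta)=0\quad\text{and}\quad \phi_\xi(\xi)=\xi\qquad\text{for all }\xi,\zeta\in V^*. \] Then $\mathrm{Jac}=0$ if and only if $\mathrm{MC}_\phi=0$. More precisely, for all $\xi,\zeta,\eta\in V^*$, \[ \mathrm{Jac}(\xi,\zeta,\eta)=-3\,\frac{d}{dt}(\mathrm{MC}_\phi)_{t\xi}(\zeta,\eta)\Big|_{t=0}, \] \[ (\mathrm{MC}_\phi)_\xi(\zeta,\eta)=-\int_0^1(\varphi^{t-1}_{X_\xi})^*\,\mathrm{Jac}\big(\xi,\phi_{t\xi}(t\zeta),\phi_{t\xi}(t\eta)\big)\,dt. \]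
   Context: The pair $(\mathcal{O},\pi)$ is a pre-Poisson manifold (the Poisson equation is not assumed). It induces the bracket $\{f,g\}=\pi(df,dg)$ on $C^\infty(\mathcal{O})$ with Jacobiator $\mathrm{Jac}(f,g,h)=\{\{f,g\},h\}+\{\{g,h\},f\}+\{\{h,f\},g\}$. The Hamiltonian vector field $X_f$ is defined by $X_f(g)=\{f,g\}$. Elements of $V^*$ are regarded as linear functions restricted to $\mathcal{O}$. $\varphi^t_{X_\xi}$ denotes the flow of $X_\xi$. $\Omega^*(V^*;C^\infty(\mathcal{O}))$ denotes smooth differential forms on $V^*$ with values in $C^\infty(\mathcal{O})$ (tangent spaces of $V^*$ identified with $V^*$), with de Rham differential $d$ and the bracket $\{\omega,\eta\}(X_1,\dots,X_{p+q})=\sum_{\sigma\in S_{p,q}}\mathrm{sgn}(\sigma)\{\omega(X_{\sigma(1)},\dots),\eta(X_{\sigma(p+1)},\dots)\}$. The Maurer–Cartan 2-form is $\mathrm{MC}_\phi=d\phi+\tfrac12\{\phi,\phi\}$.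
   Formalization: The integral formula and the implication Jac=0 ⇒ MC_φ=0 are stated at those ξ and points x of O for which the integral curve of X_ξ through x exists in O on [-1,0]; elsewhere the flow is undefined and the implication can fail. *)

theory Defs
  imports "HOL-Analysis.Analysis"
begin

text \<open>V is modelled by a type 'v of class euclidean_space (finite-dimensional real
vector space); its dual V* is the space of (bounded) linear functionals 'v =>L real.\<close>

type_synonym 'v dual = "'v \<Rightarrow>\<^sub>L real"

fun iter_dd :: "('a::real_normed_vector \<Rightarrow> real) \<Rightarrow> 'a list \<Rightarrow> 'a \<Rightarrow> real" where
  "iter_dd f [] = f"
| "iter_dd f (v # vs) = (\<lambda>x. frechet_derivative (iter_dd f vs) (at x) v)"

definition smooth_on :: "'a::real_normed_vector set \<Rightarrow> ('a \<Rightarrow> real) \<Rightarrow> bool" where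
  "smooth_on S f \<longleftrightarrow> (\<forall>vs. \<forall>x\<in>S. iter_dd f vs differentiable (at x))"

definition dfun :: "('v::euclidean_space \<Rightarrow> real) \<Rightarrow> 'v \<Rightarrow> 'v dual" where
  "dfun f x = Blinfun (frechet_derivative f (at x))"

definition bivector_field :: "'v::euclidean_space set \<Rightarrow> ('v \<Rightarrow> 'v dual \<Rightarrow> 'v dual \<Rightarrow> real) \<Rightarrow> bool" where
  "bivector_field O' \<pi> \<longleftrightarrow>
     (\<forall>x\<in>O'. bilinear (\<pi> x) \<and> (\<forall>\<alpha> \<beta>. \<pi> x \<alpha> \<beta> = - \<pi> x \<beta> \<alpha>)) \<and>
     (\<forall>\<alpha> \<beta>. smooth_on O' (\<lambda>x. \<pi> x \<alpha> \<beta>))"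

definition pbr :: "('v::euclidean_space \<Rightarrow> 'v dual \<Rightarrow> 'v dual \<Rightarrow> real) \<Rightarrow>
    ('v \<Rightarrow> real) \<Rightarrow> ('v \<Rightarrow> real) \<Rightarrow> 'v \<Rightarrow> real" where
  "pbr \<pi> f g = (\<lambda>x. \<pi> x (dfun f x) (dfun g x))"

definition Jac :: "('v::euclidean_space \<Rightarrow> 'v dual \<Rightarrow> 'v dual \<Rightarrow> real) \<Rightarrow>
    ('v \<Rightarrow> real) \<Rightarrow> ('v \<Rightarrow> real) \<Rightarrow> ('v \<Rightarrow> real) \<Rightarrow> 'v \<Rightarrow> real" where
  "Jac \<pi> f g h = (\<lambda>x. pbr \<pi> (pbr \<pi> f g) h x + pbr \<pi> (pbr \<pi> g h) f x + pbr \<pi> (pbr \<pi> h f) g x)"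

text \<open>Hamiltonian vector field X_f: the tangent vector v at x with alpha(v) = pi_x(df, alpha)
  for every covector alpha, i.e. X_f(g) = {f,g}.\<close>
definition ham_vf :: "('v::euclidean_space \<Rightarrow> 'v dual \<Rightarrow> 'v dual \<Rightarrow> real) \<Rightarrow>
    ('v \<Rightarrow> real) \<Rightarrow> 'v \<Rightarrow> 'v" where
  "ham_vf \<pi> f x = (THE v. \<forall>\<alpha>. blinfun_apply \<alpha> v = \<pi> x (dfun f x) \<alpha>)"

text \<open>A 1-form phi on V* with values in C-infinity(O): phi xi zeta x = (phi_xi(zeta))(x),
  linear in zeta, smooth in (xi, x).\<close>
definition form1 :: "'v::euclidean_space set \<Rightarrow> ('v dual \<Rightarrow> 'v dual \<Rightarrow> 'v \<Rightarrow> real) \<Rightarrow> bool" where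
  "form1 O' \<phi> \<longleftrightarrow>
     (\<forall>\<xi>. \<forall>x\<in>O'. linear (\<lambda>\<zeta>. \<phi> \<xi> \<zeta> x)) \<and>
     (\<forall>\<zeta>. smooth_on (UNIV \<times> O') (\<lambda>(\<xi>, x). \<phi> \<xi> \<zeta> x))"

text \<open>de Rham differential of a 1-form on V* (constant vector fields zeta, eta):
  (d phi)_xi(zeta,eta) = D_zeta (phi(eta))_xi - D_eta (phi(zeta))_xi.\<close>
definition dR1 :: "('v::euclidean_space dual \<Rightarrow> 'v dual \<Rightarrow> 'v \<Rightarrow> real) \<Rightarrow>
    'v dual \<Rightarrow> 'v dual \<Rightarrow> 'v dual \<Rightarrow> 'v \<Rightarrow> real" where
  "dR1 \<phi> \<xi> \<zeta> \<eta> x =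
     frechet_derivative (\<lambda>\<xi>'. \<phi> \<xi>' \<eta> x) (at \<xi>) \<zeta> - frechet_derivative (\<lambda>\<xi>'. \<phi> \<xi>' \<zeta> x) (at \<xi>) \<eta>"

text \<open>Bracket of two 1-forms: sum over (1,1)-shuffles.\<close>
definition fbr11 :: "('v::euclidean_space \<Rightarrow> 'v dual \<Rightarrow> 'v dual \<Rightarrow> real) \<Rightarrow>
    ('v dual \<Rightarrow> 'v dual \<Rightarrow> 'v \<Rightarrow> real) \<Rightarrow> ('v dual \<Rightarrow> 'v dual \<Rightarrow> 'v \<Rightarrow> real) \<Rightarrow>
    'v dual \<Rightarrow> 'v dual \<Rightarrow> 'v dual \<Rightarrow> 'v \<Rightarrow> real" where
  "fbr11 \<pi> \<omega> \<theta> \<xi> \<zeta> \<eta> x = pbr \<pi> (\<omega> \<xi> \<zeta>) (\<theta> \<xi> \<eta>) x - pbr \<pi> (\<omega> \<xi> \<eta>) (\<theta> \<xi> \<zeta>) x"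

definition MC :: "('v::euclidean_space \<Rightarrow> 'v dual \<Rightarrow> 'v dual \<Rightarrow> real) \<Rightarrow>
    ('v dual \<Rightarrow> 'v dual \<Rightarrow> 'v \<Rightarrow> real) \<Rightarrow> 'v dual \<Rightarrow> 'v dual \<Rightarrow> 'v dual \<Rightarrow> 'v \<Rightarrow> real" where
  "MC \<pi> \<phi> \<xi> \<zeta> \<eta> x = dR1 \<phi> \<xi> \<zeta> \<eta> x + (1/2) * fbr11 \<pi> \<phi> \<phi> \<xi> \<zeta> \<eta> x"

text \<open>gamma is the integral curve s |-> flow^s_{X_f}(x) of X_f on the time interval [-1,0], inside O.\<close>
definition flow_curve :: "'v::euclidean_space set \<Rightarrow> ('v \<Rightarrow> 'v dual \<Rightarrow> 'v dual \<Rightarrow> real) \<Rightarrow>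
    ('v \<Rightarrow> real) \<Rightarrow> 'v \<Rightarrow> (real \<Rightarrow> 'v) \<Rightarrow> bool" where
  "flow_curve O' \<pi> f x \<gamma> \<longleftrightarrow> \<gamma> 0 = x \<and>
     (\<forall>s\<in>{-1..0}. \<gamma> s \<in> O' \<and>
        (\<gamma> has_vector_derivative ham_vf \<pi> f (\<gamma> s)) (at s within {-1..0}))"

end

theory Submission
  imports Defs
begin

text \<open>Differentiating \<open>\<phi>\<^sub>p(p) = p\<close> and \<open>MC\<^sub>p(p, _) = 0\<close> in \<open>p\<close> turns the diagonal case
  \<open>X = p = \<xi>\<close> of the Bianchi identity for \<open>MC\<close> into a transport equation along the ray through
  \<open>\<xi>\<close>,
  \<open>d/dt (t\<^sup>2 MC\<^bsub>t\<xi>\<^esub>(\<zeta>, \<eta>)) + {\<xi>, t\<^sup>2 MC\<^bsub>t\<xi>\<^esub>(\<zeta>, \<eta>)} = - Jac(\<xi>, \<phi>\<^bsub>t\<xi>\<^esub>(t\<zeta>), \<phi>\<^bsub>t\<xi>\<^esub>(t\<eta>))\<close>.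
  The bracket with \<open>\<xi>\<close> is the derivative along the Hamiltonian flow, so integrating over
  \<open>0 \<le> t \<le> 1\<close> along that flow gives the integral formula. At order \<open>t\<^sup>2\<close>, using \<open>MC\<^sub>0 = 0\<close> and
  \<open>\<phi>\<^sub>0(\<zeta>) = \<zeta>\<close>, it gives the derivative formula. Since the Jacobiator at a point only depends on
  the differentials of its arguments, it vanishes as soon as it does on linear functions.\<close>

section \<open>Smooth functions\<close>

lemma iter_dd_append: "iter_dd f (vs @ ws) = iter_dd (iter_dd f ws) vs"
  by (induction vs) auto

lemma smooth_on_differentiable: "smooth_on S f \<Longrightarrow> x \<in> S \<Longrightarrow> f differentiable (at x)"
  unfolding smooth_on_def by (metis iter_dd.simps(1))

lemma smooth_on_has_derivative:
  "smooth_on S f \<Longrightarrow> x \<in> S \<Longrightarrow> (f has_derivative frechet_derivative f (at x)) (at x)"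
  using smooth_on_differentiable frechet_derivative_works by blast

lemma smooth_on_frechet_derivative:
  assumes "smooth_on S f"
  shows "smooth_on S (\<lambda>x. frechet_derivative f (at x) v)"
proof -
  have "iter_dd (\<lambda>x. frechet_derivative f (at x) v) vs = iter_dd f (vs @ [v])" for vs
    by (simp add: iter_dd_append)
  then show ?thesis
    using assms by (simp add: smooth_on_def)
qed

text \<open>If a class of functions is closed under directional derivatives and its members are
  differentiable on \<open>S\<close>, it contains all iterated derivatives of its members.
  Smoothness proofs thus reduce to finding such an invariant \<open>Q\<close>.\<close>

lemma smooth_on_coinduct:
  assumes "Q f"
    and Q: "\<And>f x. Q f \<Longrightarrow> x \<in> S \<Longrightarrow> f differentiable (at x)"
      "\<And>f v. Q f \<Longrightarrow> Q (\<lambda>x. frechet_derivative f (at x) v)"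
  shows "smooth_on S f"
proof -
  have "Q (iter_dd f vs)" for vs
    by (induction vs) (use assms in auto)
  then show ?thesis
    using Q(1) by (auto simp: smooth_on_def)
qed

section \<open>Calculus rules and the algebra of smooth functions\<close>

text \<open>Being a derivative at \<open>x\<close> is a local property, so the choice operator
  behind \<open>frechet_derivative\<close> meets the same predicate on both sides. This covers
  points of non-differentiability as well.\<close>

lemma frechet_derivative_cong_open:
  assumes "open S" "x \<in> S" "\<And>y. y \<in> S \<Longrightarrow> f y = g y"
  shows "frechet_derivative f (at x) = frechet_derivative g (at x)"
proof -
  have "(f has_derivative D) (at x) \<longleftrightarrow> (g has_derivative D) (at x)" for D
    using has_derivative_transform_within_open[of f D x UNIV S g]
      has_derivative_transform_within_open[of g D x UNIV S f] assms by auto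
  then show ?thesis
    by (simp add: frechet_derivative_def)
qed

lemma differentiable_cong_open:
  assumes "open S" "x \<in> S" "\<And>y. y \<in> S \<Longrightarrow> f y = g y" "f differentiable (at x)"
  shows "g differentiable (at x)"
  using assms has_derivative_transform_within_open[of f _ x UNIV S g]
  by (auto simp: differentiable_def)

lemma frechet_derivative_eqI:
  "(f has_derivative D) (at x) \<Longrightarrow> frechet_derivative f (at x) v = D v"
  using frechet_derivative_at by metis

lemma frechet_derivative_add:
  fixes f g :: "'a::real_normed_vector \<Rightarrow> real"
  assumes "f differentiable (at x)" "g differentiable (at x)"
  shows "frechet_derivative (\<lambda>x. f x + g x) (at x) v =
    frechet_derivative f (at x) v + frechet_derivative g (at x) v"
  by (rule frechet_derivative_eqI)
    (use assms in \<open>auto simp: frechet_derivative_works intro!: derivative_intros\<close>)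

lemma frechet_derivative_mult:
  fixes f g :: "'a::real_normed_vector \<Rightarrow> real"
  assumes "f differentiable (at x)" "g differentiable (at x)"
  shows "frechet_derivative (\<lambda>x. f x * g x) (at x) v =
    frechet_derivative f (at x) v * g x + f x * frechet_derivative g (at x) v"
proof -
  have "((\<lambda>x. f x * g x) has_derivative (\<lambda>v. f x * frechet_derivative g (at x) v +
    frechet_derivative f (at x) v * g x)) (at x)"
    using assms by (auto simp: frechet_derivative_works intro!: has_derivative_mult)
  from frechet_derivative_eqI[OF this] show ?thesis
    by simp
qed

lemma frechet_derivative_sum:
  fixes f :: "'i \<Rightarrow> 'a::real_normed_vector \<Rightarrow> real"
  assumes "\<And>i. i \<in> I \<Longrightarrow> f i differentiable (at x)"
  shows "frechet_derivative (\<lambda>x. \<Sum>i\<in>I. f i x) (at x) v = (\<Sum>i\<in>I. frechet_derivative (f i) (at x) v)"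
  by (rule frechet_derivative_eqI, rule has_derivative_sum)
    (use assms in \<open>simp add: frechet_derivative_works\<close>)

lemma frechet_derivative_cmult:
  fixes f :: "'a::real_normed_vector \<Rightarrow> real"
  assumes "f differentiable (at x)"
  shows "frechet_derivative (\<lambda>x. c * f x) (at x) v = c * frechet_derivative f (at x) v"
  using assms by (simp add: frechet_derivative_mult)

text \<open>Products of smooth functions alone are not closed under derivatives, since the product
  rule yields sums of products; the generated algebra is, and serves as the coinduction invariant.
  The rule \<open>cong\<close> admits derivative formulas that hold only on
  \<open>S\<close>.\<close>

inductive smooth_alg :: "'a::real_normed_vector set \<Rightarrow> ('a \<Rightarrow> real) \<Rightarrow> bool" for S where
  base: "smooth_on S f \<Longrightarrow> smooth_alg S f"
| sum: "smooth_alg S f \<Longrightarrow> smooth_alg S g \<Longrightarrow> smooth_alg S (\<lambda>x. f x + g x)"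
| prod: "smooth_alg S f \<Longrightarrow> smooth_alg S g \<Longrightarrow> smooth_alg S (\<lambda>x. f x * g x)"
| cong: "smooth_alg S f \<Longrightarrow> (\<And>x. x \<in> S \<Longrightarrow> f x = g x) \<Longrightarrow> smooth_alg S g"

lemma smooth_alg_deriv:
  assumes "smooth_alg S f" "open S"
  shows "(\<forall>x\<in>S. f differentiable (at x)) \<and>
    (\<forall>v. smooth_alg S (\<lambda>x. frechet_derivative f (at x) v))"
  using assms(1)
proof induction
  case (base f)
  then show ?case
    by (auto intro: smooth_on_differentiable smooth_alg.base smooth_on_frechet_derivative)
next
  case (sum f g)
  have "smooth_alg S (\<lambda>x. frechet_derivative (\<lambda>x. f x + g x) (at x) v)" for v
    by (rule smooth_alg.cong[OF smooth_alg.sum[of _ "\<lambda>x. frechet_derivative f (at x) v"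
          "\<lambda>x. frechet_derivative g (at x) v"]]) (use sum in \<open>auto simp: frechet_derivative_add\<close>)
  with sum show ?case
    by auto
next
  case (prod f g)
  have "smooth_alg S (\<lambda>x. frechet_derivative (\<lambda>x. f x * g x) (at x) v)" for v
    by (rule smooth_alg.cong[where f = "\<lambda>x. frechet_derivative f (at x) v * g x +
          f x * frechet_derivative g (at x) v"])
      (use prod in \<open>auto simp: frechet_derivative_mult intro!: smooth_alg.sum smooth_alg.prod\<close>)
  with prod show ?case
    by auto
next
  case (cong f g)
  have "smooth_alg S (\<lambda>x. frechet_derivative g (at x) v)" for v
    by (rule smooth_alg.cong[where f = "\<lambda>x. frechet_derivative f (at x) v"])
      (use cong frechet_derivative_cong_open[OF assms(2), of _ f g] in auto)
  with cong assms(2) show ?case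
    using differentiable_cong_open[OF assms(2)] by metis
qed

lemma smooth_alg_smooth_on: "open S \<Longrightarrow> smooth_alg S f \<Longrightarrow> smooth_on S f"
  by (rule smooth_on_coinduct[of "smooth_alg S"]) (use smooth_alg_deriv in blast)+

lemma smooth_on_add:
  "open S \<Longrightarrow> smooth_on S f \<Longrightarrow> smooth_on S g \<Longrightarrow> smooth_on S (\<lambda>x. f x + g x)"
  by (rule smooth_alg_smooth_on) (auto intro: smooth_alg.intros(1,2))

lemma smooth_on_mult:
  "open S \<Longrightarrow> smooth_on S f \<Longrightarrow> smooth_on S g \<Longrightarrow> smooth_on S (\<lambda>x. f x * g x)"
  by (rule smooth_alg_smooth_on) (auto intro: smooth_alg.intros(1,3))

lemma smooth_on_cong:
  "open S \<Longrightarrow> smooth_on S f \<Longrightarrow> (\<And>x. x \<in> S \<Longrightarrow> f x = g x) \<Longrightarrow> smooth_on S g"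
  by (rule smooth_alg_smooth_on) (auto intro: smooth_alg.cong[OF smooth_alg.base])

lemma smooth_on_const: "smooth_on S (\<lambda>x. c)"
  by (rule smooth_on_coinduct[of "\<lambda>f. \<exists>c. f = (\<lambda>x. c)"]) auto

lemma smooth_on_cmult: "open S \<Longrightarrow> smooth_on S f \<Longrightarrow> smooth_on S (\<lambda>x. c * f x)"
  by (intro smooth_on_mult smooth_on_const)

lemma smooth_on_minus: "open S \<Longrightarrow> smooth_on S f \<Longrightarrow> smooth_on S (\<lambda>x. - f x)"
  using smooth_on_cmult[of S f "-1"] by simp

lemma smooth_on_diff:
  "open S \<Longrightarrow> smooth_on S f \<Longrightarrow> smooth_on S g \<Longrightarrow> smooth_on S (\<lambda>x. f x - g x)"
  using smooth_on_add[of S f "\<lambda>x. - g x"] smooth_on_minus by auto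

lemma smooth_on_sum:
  assumes "open S" "finite I" "\<And>i. i \<in> I \<Longrightarrow> smooth_on S (f i)"
  shows "smooth_on S (\<lambda>x. \<Sum>i\<in>I. f i x)"
  using assms(2,3) by (induction I) (auto intro: smooth_on_const smooth_on_add[OF assms(1)])

section \<open>Affine substitutions and linear functions\<close>

lemma frechet_derivative_affine:
  assumes "f differentiable (at (h x))" "\<And>x. (h has_derivative L) (at x)"
  shows "(f \<circ> h) differentiable (at x)"
    "frechet_derivative (f \<circ> h) (at x) v = frechet_derivative f (at (h x)) (L v)"
proof -
  have "(f \<circ> h has_derivative frechet_derivative f (at (h x)) \<circ> L) (at x)"
    using assms by (auto intro!: diff_chain_at simp: frechet_derivative_works)
  then show "(f \<circ> h) differentiable (at x)"
    "frechet_derivative (f \<circ> h) (at x) v = frechet_derivative f (at (h x)) (L v)"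
    by (auto simp: differentiable_def frechet_derivative_eqI)
qed

text \<open>The derivative \<open>L\<close> of \<open>h\<close> is the same at every point, so
  differentiating \<open>f \<circ> h\<close> along \<open>v\<close> gives the derivative of
  \<open>f\<close> along \<open>L v\<close>, again composed with \<open>h\<close>. The invariant
  asks for agreement on \<open>T\<close> only, because the chain rule needs \<open>h x\<close> in
  \<open>S\<close>.\<close>

lemma smooth_on_affine:
  assumes "smooth_on S f" "\<And>x. (h has_derivative L) (at x)" "\<And>x. x \<in> T \<Longrightarrow> h x \<in> S" "open T"
  shows "smooth_on T (f \<circ> h)"
proof (rule smooth_on_coinduct[of "\<lambda>k. \<exists>f. smooth_on S f \<and> (\<forall>x\<in>T. k x = (f \<circ> h) x)"])
  show "\<exists>f'. smooth_on S f' \<and> (\<forall>x\<in>T. (f \<circ> h) x = (f' \<circ> h) x)"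
    using assms(1) by blast
next
  fix k x assume "\<exists>f. smooth_on S f \<and> (\<forall>x\<in>T. k x = (f \<circ> h) x)" "x \<in> T"
  then obtain f where f: "smooth_on S f" "\<forall>x\<in>T. k x = (f \<circ> h) x"
    by blast
  have "(f \<circ> h) differentiable (at x)"
    using f(1) \<open>x \<in> T\<close> assms by (intro frechet_derivative_affine smooth_on_differentiable) auto
  then show "k differentiable (at x)"
    using differentiable_cong_open[OF assms(4) \<open>x \<in> T\<close>] f(2) by metis
next
  fix k v assume "\<exists>f. smooth_on S f \<and> (\<forall>x\<in>T. k x = (f \<circ> h) x)"
  then obtain f where f: "smooth_on S f" "\<forall>x\<in>T. k x = (f \<circ> h) x"
    by blast
  have "frechet_derivative k (at x) v = ((\<lambda>y. frechet_derivative f (at y) (L v)) \<circ> h) x"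
    if "x \<in> T" for x
  proof -
    have "frechet_derivative k (at x) v = frechet_derivative (f \<circ> h) (at x) v"
      using frechet_derivative_cong_open[OF assms(4) that, of k "f \<circ> h"] f(2) by auto
    also have "\<dots> = frechet_derivative f (at (h x)) (L v)"
      using f(1) that assms by (intro frechet_derivative_affine smooth_on_differentiable) auto
    finally show ?thesis
      by simp
  qed
  then show "\<exists>g. smooth_on S g \<and>
      (\<forall>x\<in>T. frechet_derivative k (at x) v = (g \<circ> h) x)"
    using smooth_on_frechet_derivative[OF f(1)] by blast
qed

lemma smooth_on_bounded_linear:
  assumes "bounded_linear f"
  shows "smooth_on S f"
proof (rule smooth_on_coinduct[of "\<lambda>g. bounded_linear g \<or> (\<exists>c. g = (\<lambda>x. c))"])
  fix g :: "'a \<Rightarrow> real" and v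
  assume "bounded_linear g \<or> (\<exists>c. g = (\<lambda>x. c))"
  then have "\<exists>c. (\<lambda>x. frechet_derivative g (at x) v) = (\<lambda>x. c)"
    using frechet_derivative_eqI[OF bounded_linear_imp_has_derivative, of g _ v] by auto
  then show "bounded_linear (\<lambda>x. frechet_derivative g (at x) v) \<or>
      (\<exists>c. (\<lambda>x. frechet_derivative g (at x) v) = (\<lambda>x. c))"
    by blast
qed (use assms in \<open>auto intro: bounded_linear_imp_differentiable\<close>)

lemma smooth_blinfun_apply: "smooth_on S (blinfun_apply \<xi>)" for \<xi> :: "'a::real_normed_vector \<Rightarrow>\<^sub>L real"
  by (rule smooth_on_bounded_linear) (rule blinfun.bounded_linear_right)

section \<open>Derivatives along lines, polarization, symmetry of second derivatives\<close>

lemma smooth_on_isCont: "smooth_on S f \<Longrightarrow> x \<in> S \<Longrightarrow> isCont f x"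
  using smooth_on_differentiable differentiable_imp_continuous_within by blast

lemma smooth_on_line_derivative:
  fixes f :: "'a::real_normed_vector \<Rightarrow> real"
  assumes "smooth_on S f" "x + s *\<^sub>R v \<in> S"
  shows "((\<lambda>s. f (x + s *\<^sub>R v)) has_real_derivative
    frechet_derivative f (at (x + s *\<^sub>R v)) v) (at s)"
proof -
  let ?D = "frechet_derivative f (at (x + s *\<^sub>R v))"
  have "((\<lambda>s. x + s *\<^sub>R v) has_derivative (\<lambda>s. s *\<^sub>R v)) (at s)"
    by (auto intro!: derivative_eq_intros)
  then have "((\<lambda>s. f (x + s *\<^sub>R v)) has_derivative (\<lambda>s. ?D (s *\<^sub>R v))) (at s)"
    using has_derivative_compose smooth_on_has_derivative[OF assms] by blast
  moreover have "?D (s *\<^sub>R v) = s * ?D v" for s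
    using linear_frechet_derivative[OF smooth_on_differentiable[OF assms]]
    by (simp add: linear_cmul)
  ultimately show ?thesis
    by (simp add: has_field_derivative_def mult.commute[of _ "?D v"])
qed

text \<open>The identity says that the difference quotient of \<open>a\<close> at \<xi> along
  \<zeta> is \<open>- b (\<xi> + s *\<^sub>R \<zeta>)\<close>, which converges by continuity of
  \<open>b\<close>. All radial identities for \<open>\<phi>\<close> and \<open>MC\<close> are
  differentiated in this way.\<close>

lemma polarize_at_zero:
  fixes a b :: "'p::real_normed_vector \<Rightarrow> real"
  assumes "smooth_on UNIV a" "isCont b \<xi>"
    and eq: "\<And>s. a (\<xi> + s *\<^sub>R \<zeta>) + s * b (\<xi> + s *\<^sub>R \<zeta>) = c"
  shows "frechet_derivative a (at \<xi>) \<zeta> = - b \<xi>"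
proof -
  have "((\<lambda>s. a (\<xi> + s *\<^sub>R \<zeta>)) has_real_derivative frechet_derivative a (at \<xi>) \<zeta>) (at 0)"
    using smooth_on_line_derivative[OF assms(1), of \<xi> 0 \<zeta>] by simp
  then have "(\<lambda>s. (a (\<xi> + s *\<^sub>R \<zeta>) - a \<xi>) / s) \<midarrow>0\<rightarrow> frechet_derivative a (at \<xi>) \<zeta>"
    by (simp add: has_field_derivative_iff)
  moreover have "\<forall>\<^sub>F s in at 0. (a (\<xi> + s *\<^sub>R \<zeta>) - a \<xi>) / s = - b (\<xi> + s *\<^sub>R \<zeta>)"
  proof -
    have "a (\<xi> + s *\<^sub>R \<zeta>) - a \<xi> = - (s * b (\<xi> + s *\<^sub>R \<zeta>))" for s
      using eq[of s] eq[of 0] by simp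
    then show ?thesis
      by (auto simp: eventually_at_filter)
  qed
  ultimately have "(\<lambda>s. - b (\<xi> + s *\<^sub>R \<zeta>)) \<midarrow>0\<rightarrow> frechet_derivative a (at \<xi>) \<zeta>"
    by (rule Lim_transform_eventually)
  moreover have "(\<lambda>s. - b (\<xi> + s *\<^sub>R \<zeta>)) \<midarrow>0\<rightarrow> - b \<xi>"
  proof -
    have "isCont (\<lambda>s. b (\<xi> + s *\<^sub>R \<zeta>)) 0"
      by (rule isCont_o2[where g = b]) (use assms(2) in auto)
    then show ?thesis
      by (auto simp: isCont_def intro!: tendsto_minus)
  qed
  ultimately show ?thesis
    using LIM_unique by blast
qed

text \<open>The second difference of \<open>f\<close> along \<open>v\<close> and \<open>w\<close> is written, by the mean value theorem
  along \<open>v\<close>, through the derivative of \<open>f\<close> along \<open>v\<close>; its quotient by \<open>h\<^sup>2\<close> then tends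
  to the iterated derivative.\<close>

lemma second_difference_tendsto:
  fixes f :: "'a::real_normed_vector \<Rightarrow> real"
  assumes "open S" "x \<in> S" "smooth_on S f"
  shows "((\<lambda>h. (f (x + h *\<^sub>R v + h *\<^sub>R w) - f (x + h *\<^sub>R v) - f (x + h *\<^sub>R w) + f x) / h\<^sup>2) \<longlongrightarrow>
    frechet_derivative (\<lambda>y. frechet_derivative f (at y) v) (at x) w) (at_right 0)"
proof -
  define g where "g = (\<lambda>y. frechet_derivative f (at y) v)"
  define G where "G = frechet_derivative g (at x)"
  \<comment> \<open>The summand 1 makes the norm bound strict and keeps \<open>N\<close> positive
    even if \<open>v\<close> and \<open>w\<close> vanish.\<close>
  define N where "N = norm v + norm w + 1"
  have N: "N > 0" "norm v + norm w < N"
    by (auto simp: N_def intro: add_nonneg_pos)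
  have G: "(g has_derivative G) (at x)"
    unfolding g_def G_def
    using smooth_on_has_derivative[OF smooth_on_frechet_derivative[OF assms(3)] assms(2)] .
  then have linG: "linear G"
    using has_derivative_linear by blast
  obtain r where r: "r > 0" "ball x r \<subseteq> S"
    using assms(1,2) openE by blast
  show ?thesis
    unfolding g_def[symmetric] G_def[symmetric] tendsto_iff
  proof (intro allI impI)
    fix e :: real assume "e > 0"
    \<comment> \<open>Two first-order remainders of \<open>g\<close> occur below, each smaller than
      \<open>e' * (h * N)\<close>, so that their sum stays below \<open>h * e\<close>.\<close>
    define e' where "e' = e / (2 * N)"
    have e': "e' > 0" "2 * (e' * N) = e"
      using \<open>e > 0\<close> N by (auto simp: e'_def)
    obtain d where d: "d > 0"
      "\<And>y. norm (y - x) < d \<Longrightarrow> norm (g y - g x - G (y - x)) \<le> e' * norm (y - x)"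
      using G e'(1) by (metis has_derivative_at_alt)
    \<comment> \<open>For \<open>h < h0\<close> all increments are shorter than \<open>r\<close>,
      which keeps the points in \<open>S\<close>, and shorter than \<open>d\<close>, where the
      remainder bound holds.\<close>
    define h0 where "h0 = min r d / N"
    have "h0 > 0"
      using r d N by (simp add: h0_def)
    have key: "dist ((f (x + h *\<^sub>R v + h *\<^sub>R w) - f (x + h *\<^sub>R v) - f (x + h *\<^sub>R w) + f x) / h\<^sup>2) (G w) < e"
      if h: "0 < h" "h < h0" for h
    proof -
      have hN: "h * N < r" "h * N < d"
        using h N by (auto simp: h0_def pos_less_divide_eq)
      have small: "norm (s *\<^sub>R v + t *\<^sub>R w) < h * N" if "0 \<le> s" "s \<le> h" "0 \<le> t" "t \<le> h" for s t
      proof -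
        have "norm (s *\<^sub>R v + t *\<^sub>R w) \<le> s * norm v + t * norm w"
          using norm_triangle_ineq[of "s *\<^sub>R v" "t *\<^sub>R w"] that by simp
        also have "\<dots> \<le> h * norm v + h * norm w"
          using that by (intro add_mono mult_right_mono) auto
        also have "\<dots> < h * N"
          using N(2) h(1) by (simp add: distrib_left[symmetric])
        finally show ?thesis .
      qed
      have inS: "x + s *\<^sub>R v + t *\<^sub>R w \<in> S" if "0 \<le> s" "s \<le> h" "0 \<le> t" "t \<le> h" for s t
        using small[OF that] hN(1) r(2) by (auto simp: subset_iff dist_norm norm_minus_commute
          add.assoc)
      define F where "F = (\<lambda>s. f (x + s *\<^sub>R v + h *\<^sub>R w) - f (x + s *\<^sub>R v))"
      have DF: "(F has_real_derivative (g (x + s *\<^sub>R v + h *\<^sub>R w) - g (x + s *\<^sub>R v))) (at s)"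
        if "0 \<le> s" "s \<le> h" for s
      proof -
        have "x + h *\<^sub>R w + s *\<^sub>R v \<in> S" "x + s *\<^sub>R v \<in> S"
          using inS[of s h] inS[of s 0] that h by (auto simp: algebra_simps)
        then have "((\<lambda>s. f (x + h *\<^sub>R w + s *\<^sub>R v) - f (x + s *\<^sub>R v)) has_real_derivative
          (g (x + h *\<^sub>R w + s *\<^sub>R v) - g (x + s *\<^sub>R v))) (at s)"
          unfolding g_def by (intro DERIV_diff smooth_on_line_derivative[OF assms(3)])
        then show ?thesis
          by (simp add: F_def algebra_simps)
      qed
      obtain s where s: "0 < s" "s < h"
        "F h - F 0 = h * (g (x + s *\<^sub>R v + h *\<^sub>R w) - g (x + s *\<^sub>R v))"
        using MVT2[of 0 h F "\<lambda>s. g (x + s *\<^sub>R v + h *\<^sub>R w) - g (x + s *\<^sub>R v)"] DF h(1) by auto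
      have b1: "norm (g (x + s *\<^sub>R v + h *\<^sub>R w) - g x - G (s *\<^sub>R v + h *\<^sub>R w)) \<le>
        e' * norm (s *\<^sub>R v + h *\<^sub>R w)"
        using d(2)[of "x + s *\<^sub>R v + h *\<^sub>R w"] small[of s h] s h hN by (simp add: add.assoc)
      have b2: "norm (g (x + s *\<^sub>R v) - g x - G (s *\<^sub>R v)) \<le> e' * norm (s *\<^sub>R v)"
        using d(2)[of "x + s *\<^sub>R v"] small[of s 0] s h hN by simp
      have Gw: "G (s *\<^sub>R v + h *\<^sub>R w) = G (s *\<^sub>R v) + h * G w"
        using linG by (simp add: linear_add linear_cmul)
      have "\<bar>(g (x + s *\<^sub>R v + h *\<^sub>R w) - g (x + s *\<^sub>R v)) - h * G w\<bar> \<le>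
        e' * norm (s *\<^sub>R v + h *\<^sub>R w) + e' * norm (s *\<^sub>R v)"
        using b1 b2 unfolding Gw real_norm_def by linarith
      also have "\<dots> < e' * (h * N) + e' * (h * N)"
        using small[of s h] small[of s 0] s h e'(1) by (intro add_strict_mono) auto
      also have "\<dots> = h * e"
        using e'(2) by (simp add: algebra_simps)
      finally have "\<bar>(g (x + s *\<^sub>R v + h *\<^sub>R w) - g (x + s *\<^sub>R v)) - h * G w\<bar> / h < e"
        using h(1) by (simp add: pos_divide_less_eq mult.commute)
      moreover have "(f (x + h *\<^sub>R v + h *\<^sub>R w) - f (x + h *\<^sub>R v) - f (x + h *\<^sub>R w) + f x) / h\<^sup>2 =
        (g (x + s *\<^sub>R v + h *\<^sub>R w) - g (x + s *\<^sub>R v)) / h"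
      proof -
        have "f (x + h *\<^sub>R v + h *\<^sub>R w) - f (x + h *\<^sub>R v) - f (x + h *\<^sub>R w) + f x = F h - F 0"
          by (simp add: F_def)
        then show ?thesis
          using h(1) by (simp add: s(3) power2_eq_square)
      qed
      moreover have "\<bar>q / h - c\<bar> = \<bar>q - h * c\<bar> / h" for q c
      proof -
        have "q / h - c = (q - h * c) / h"
          using h(1) by (simp add: diff_divide_distrib)
        then show ?thesis
          using h(1) by (simp only: abs_divide abs_of_pos)
      qed
      ultimately show ?thesis
        by (simp add: dist_real_def)
    qed
    have "\<forall>\<^sub>F h in at_right 0. h \<in> {0<..<h0}"
      using \<open>h0 > 0\<close> eventually_at_right_real by blast
    then show "\<forall>\<^sub>F h in at_right 0.
        dist ((f (x + h *\<^sub>R v + h *\<^sub>R w) - f (x + h *\<^sub>R v) - f (x + h *\<^sub>R w) + f x) / h\<^sup>2) (G w) < e"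
      by eventually_elim (use key in auto)
  qed
qed

text \<open>The second difference is symmetric in \<open>v\<close> and \<open>w\<close>, so both
  iterated derivatives are limits of one and the same quotient.\<close>

lemma frechet_derivative_commute:
  fixes f :: "'a::real_normed_vector \<Rightarrow> real"
  assumes "open S" "x \<in> S" "smooth_on S f"
  shows "frechet_derivative (\<lambda>y. frechet_derivative f (at y) v) (at x) w =
    frechet_derivative (\<lambda>y. frechet_derivative f (at y) w) (at x) v"
proof -
  have eq: "f (x + h *\<^sub>R w + h *\<^sub>R v) - f (x + h *\<^sub>R w) - f (x + h *\<^sub>R v) + f x =
    f (x + h *\<^sub>R v + h *\<^sub>R w) - f (x + h *\<^sub>R v) - f (x + h *\<^sub>R w) + f x" for h
    by (simp add: add.assoc add.commute[of "h *\<^sub>R v"])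
  show ?thesis
    using second_difference_tendsto[OF assms, of v w] second_difference_tendsto[OF assms, of w v]
    unfolding eq by (intro tendsto_unique[OF trivial_limit_at_right_real]) auto
qed

section \<open>Pre-Poisson brackets\<close>

lemma frechet_derivative_blinfun_apply: "frechet_derivative (blinfun_apply \<xi>) (at x) v = blinfun_apply \<xi> v"
  for \<xi> :: "'a::real_normed_vector \<Rightarrow>\<^sub>L real"
  by (rule frechet_derivative_eqI)
    (rule bounded_linear_imp_has_derivative[OF blinfun.bounded_linear_right])

lemma dfun_apply: "f differentiable (at x) \<Longrightarrow> blinfun_apply (dfun f x) v = frechet_derivative f (at x) v"
  unfolding dfun_def
  by (metis bounded_linear_Blinfun_apply frechet_derivative_works has_derivative_bounded_linear)

lemma dfun_blinfun_apply: "dfun (blinfun_apply \<xi>) x = \<xi>"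
  by (rule blinfun_eqI)
    (simp add: dfun_apply bounded_linear_imp_differentiable[OF blinfun.bounded_linear_right]
      frechet_derivative_blinfun_apply)

lemma dual_expand: "\<alpha> = (\<Sum>b\<in>Basis. blinfun_apply \<alpha> b *\<^sub>R blinfun_inner_left b)"
  for \<alpha> :: "'v::euclidean_space dual"
  by (rule blinfun_euclidean_eqI)
    (simp add: blinfun.sum_left scaleR_blinfun.rep_eq inner_Basis if_distrib cong: if_cong)

text \<open>A family \<open>F\<close> of functions on \<open>O'\<close> with parameter \<open>p\<close> is smooth in the sense of
  \<^const>\<open>form1\<close> if \<^term>\<open>case_prod F\<close> is smooth.\<close>

lemma smooth_family_partial:
  fixes F :: "'p::real_normed_vector \<Rightarrow> 'v::real_normed_vector \<Rightarrow> real"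
  assumes "open O'" "smooth_on (UNIV \<times> O') (case_prod F)"
  shows "smooth_on O' (F p)"
    and "x \<in> O' \<Longrightarrow> frechet_derivative (F p) (at x) v = frechet_derivative (case_prod F) (at (p, x)) (0, v)"
    and "x \<in> O' \<Longrightarrow> smooth_on UNIV (\<lambda>p. F p x)"
    and "x \<in> O' \<Longrightarrow> frechet_derivative (\<lambda>p. F p x) (at p) w = frechet_derivative (case_prod F) (at (p, x)) (w, 0)"
proof -
  have 1: "case_prod F \<circ> Pair p = F p" "(Pair p has_derivative (\<lambda>v. (0, v))) (at x)" for x
    by (auto intro!: derivative_eq_intros)
  show "smooth_on O' (F p)"
    using smooth_on_affine[OF assms(2) 1(2), of O'] assms(1) by (simp add: 1(1))
  show "frechet_derivative (F p) (at x) v = frechet_derivative (case_prod F) (at (p, x)) (0, v)"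
    if "x \<in> O'"
    using frechet_derivative_affine(2)[where x = x and v = v, OF smooth_on_differentiable[OF assms(2)] 1(2)] that
    by (simp add: 1(1))
  have 2: "case_prod F \<circ> (\<lambda>p. (p, x)) = (\<lambda>p. F p x)"
    "((\<lambda>p. (p, x)) has_derivative (\<lambda>w. (w, 0))) (at p)" for p
    by (auto intro!: derivative_eq_intros)
  show "smooth_on UNIV (\<lambda>p. F p x)" if "x \<in> O'"
    using smooth_on_affine[OF assms(2) 2(2), of UNIV] that by (simp add: 2(1))
  show "frechet_derivative (\<lambda>p. F p x) (at p) w = frechet_derivative (case_prod F) (at (p, x)) (w, 0)"
    if "x \<in> O'"
    using frechet_derivative_affine(2)[where x = p and v = w, OF smooth_on_differentiable[OF assms(2)] 2(2)] that
    by (simp add: 2(1))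
qed

text \<open>Functions without a parameter enter as constant families; results on families then
  specialize to them, with \<open>real\<close> as a dummy parameter type.\<close>

lemma smooth_family_const:
  fixes f :: "'v::real_normed_vector \<Rightarrow> real"
  assumes "open O'" "smooth_on O' f"
  shows "smooth_on (UNIV \<times> O') (case_prod (\<lambda>p::'p::real_normed_vector. f))"
proof -
  have "(\<lambda>(p::'p, x). f x) = f \<circ> snd"
    by auto
  then show ?thesis
    using smooth_on_affine[OF assms(2) bounded_linear_imp_has_derivative[OF bounded_linear_snd],
        of "(UNIV::'p set) \<times> O'"] assms(1)
    by (auto simp: open_Times)
qed

lemma smooth_family_derivative:
  fixes F :: "'p::real_normed_vector \<Rightarrow> 'v::real_normed_vector \<Rightarrow> real"
  assumes "smooth_on (UNIV \<times> O') (case_prod F)"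
  shows "smooth_on (UNIV \<times> O') (case_prod (\<lambda>p x. frechet_derivative (case_prod F) (at (p, x)) w))"
  using smooth_on_frechet_derivative[OF assms, of w] by (simp add: case_prod_unfold)

section \<open>The bracket in coordinates and Hamiltonian vector fields\<close>

locale pre_poisson =
  fixes O' :: "'v::euclidean_space set"
    and \<pi> :: "'v \<Rightarrow> 'v dual \<Rightarrow> 'v dual \<Rightarrow> real"
  assumes open_O: "open O'" and bivector: "bivector_field O' \<pi>"
begin

abbreviation \<Omega> :: "('p::real_normed_vector \<times> 'v) set" where "\<Omega> \<equiv> UNIV \<times> O'"

lemma open_\<Omega>: "open \<Omega>"
  using open_O by (simp add: open_Times)

lemma bivector_bilinear: "x \<in> O' \<Longrightarrow> bilinear (\<pi> x)"
  and bivector_antisym: "x \<in> O' \<Longrightarrow> \<pi> x \<alpha> \<beta> = - \<pi> x \<beta> \<alpha>"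
  and bivector_smooth: "smooth_on O' (\<lambda>x. \<pi> x \<alpha> \<beta>)"
  using bivector unfolding bivector_field_def by blast+

text \<open>Smoothness of \<pi> is given for fixed covectors, whereas the bracket inserts covectors
  that vary with the point. By bilinearity everything reduces to the coefficients of \<pi> on the
  dual basis.\<close>

lemma bivector_expand:
  assumes "x \<in> O'"
  shows "\<pi> x \<alpha> \<beta> = (\<Sum>b\<in>Basis. \<Sum>c\<in>Basis.
    \<pi> x (blinfun_inner_left b) (blinfun_inner_left c) * blinfun_apply \<alpha> b * blinfun_apply \<beta> c)"
proof -
  note bil = bivector_bilinear[OF assms]
  have "\<pi> x \<alpha> \<beta> = \<pi> x (\<Sum>b\<in>Basis. blinfun_apply \<alpha> b *\<^sub>R blinfun_inner_left b)
      (\<Sum>b\<in>Basis. blinfun_apply \<beta> b *\<^sub>R blinfun_inner_left b)"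
    using dual_expand by metis
  then show ?thesis
    by (simp add: bilinear_sum[OF bil] bilinear_lmul[OF bil] bilinear_rmul[OF bil]
        sum.cartesian_product mult_ac)
qed

lemma pbr_expand:
  assumes "x \<in> O'" "f differentiable (at x)" "g differentiable (at x)"
  shows "pbr \<pi> f g x = (\<Sum>b\<in>Basis. \<Sum>c\<in>Basis.
    \<pi> x (blinfun_inner_left b) (blinfun_inner_left c) *
      frechet_derivative f (at x) b * frechet_derivative g (at x) c)"
  using assms by (simp add: pbr_def bivector_expand[OF assms(1), of "dfun f x"] dfun_apply)

text \<open>The definite description in \<open>ham_vf\<close> is legitimate: \<open>?v\<close> takes
  its coordinates from the values on the dual basis, and covectors separate vectors.\<close>

lemma ham_vf_apply:
  assumes "x \<in> O'"
  shows "blinfun_apply \<alpha> (ham_vf \<pi> f x) = \<pi> x (dfun f x) \<alpha>"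
proof -
  note bil = bivector_bilinear[OF assms]
  let ?v = "\<Sum>b\<in>Basis. \<pi> x (dfun f x) (blinfun_inner_left b) *\<^sub>R b"
  have v: "blinfun_apply \<alpha> ?v = \<pi> x (dfun f x) \<alpha>" for \<alpha>
  proof -
    have "\<pi> x (dfun f x) \<alpha> = \<pi> x (dfun f x) (\<Sum>b\<in>Basis. blinfun_apply \<alpha> b *\<^sub>R blinfun_inner_left b)"
      using dual_expand by metis
    also have "\<dots> = (\<Sum>b\<in>Basis. blinfun_apply \<alpha> b * \<pi> x (dfun f x) (blinfun_inner_left b))"
      using bil by (simp add: bilinear_def linear_sum linear_cmul)
    finally show ?thesis
      by (simp add: blinfun.sum_right blinfun.scaleR_right mult.commute)
  qed
  have "u = ?v" if "\<forall>\<alpha>. blinfun_apply \<alpha> u = \<pi> x (dfun f x) \<alpha>" for u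
  proof (rule euclidean_eqI)
    fix b
    have "blinfun_apply (blinfun_inner_left b) u = blinfun_apply (blinfun_inner_left b) ?v"
      using that v by metis
    then show "u \<bullet> b = ?v \<bullet> b"
      by (simp add: inner_commute)
  qed
  then have "ham_vf \<pi> f x = ?v"
    unfolding ham_vf_def using v by (intro the_equality) auto
  then show ?thesis
    using v by simp
qed

text \<open>Turns the bracket into a directional derivative of its second argument; the algebraic
  rules below follow from those for derivatives together with antisymmetry.\<close>

lemma pbr_ham_vf:
  assumes "x \<in> O'" "g differentiable (at x)"
  shows "pbr \<pi> f g x = frechet_derivative g (at x) (ham_vf \<pi> f x)"
  using assms ham_vf_apply dfun_apply by (metis pbr_def)

lemma pbr_antisym: "x \<in> O' \<Longrightarrow> pbr \<pi> f g x = - pbr \<pi> g f x"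
  unfolding pbr_def by (rule bivector_antisym)

lemma pbr_cong:
  assumes "x \<in> O'" "\<And>y. y \<in> O' \<Longrightarrow> f y = f' y" "\<And>y. y \<in> O' \<Longrightarrow> g y = g' y"
  shows "pbr \<pi> f g x = pbr \<pi> f' g' x"
  using frechet_derivative_cong_open[OF open_O assms(1)] assms(2,3)
  unfolding pbr_def dfun_def by metis

lemma pbr_add_right:
  assumes "x \<in> O'" "g differentiable (at x)" "h differentiable (at x)"
  shows "pbr \<pi> f (\<lambda>y. g y + h y) x = pbr \<pi> f g x + pbr \<pi> f h x"
  using assms by (simp add: pbr_ham_vf frechet_derivative_add)

lemma pbr_add_left:
  assumes "x \<in> O'" "g differentiable (at x)" "h differentiable (at x)"
  shows "pbr \<pi> (\<lambda>y. g y + h y) f x = pbr \<pi> g f x + pbr \<pi> h f x"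
  using pbr_add_right[OF assms] pbr_antisym[OF assms(1)] by (smt (verit))

lemma pbr_cmult_right:
  assumes "x \<in> O'" "g differentiable (at x)"
  shows "pbr \<pi> f (\<lambda>y. c * g y) x = c * pbr \<pi> f g x"
  using assms by (simp add: pbr_ham_vf frechet_derivative_cmult)

lemma pbr_cmult_left:
  assumes "x \<in> O'" "g differentiable (at x)"
  shows "pbr \<pi> (\<lambda>y. c * g y) f x = c * pbr \<pi> g f x"
  using pbr_cmult_right[OF assms] pbr_antisym[OF assms(1)] by (metis mult_minus_right)

section \<open>Brackets of families and the Leibniz rule\<close>

lemma pbr_family_expand:
  assumes "smooth_on \<Omega> (case_prod F)" "smooth_on \<Omega> (case_prod G)" "x \<in> O'"
  shows "pbr \<pi> (F p) (G p) x = (\<Sum>b\<in>Basis. \<Sum>c\<in>Basis.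
    \<pi> x (blinfun_inner_left b) (blinfun_inner_left c) *
      frechet_derivative (case_prod F) (at (p, x)) (0, b) *
      frechet_derivative (case_prod G) (at (p, x)) (0, c))"
proof -
  note F = smooth_family_partial[OF open_O assms(1)] and G = smooth_family_partial[OF open_O assms(2)]
  show ?thesis
    using pbr_expand[OF assms(3) smooth_on_differentiable[OF F(1) assms(3)]
      smooth_on_differentiable[OF G(1) assms(3)]] F(2) G(2) assms(3) by simp
qed

lemma smooth_family_bivector:
  "smooth_on \<Omega> (case_prod (\<lambda>p::'p::real_normed_vector. \<lambda>x. \<pi> x \<alpha> \<beta>))"
  using smooth_family_const[OF open_O bivector_smooth] .

text \<open>In coordinates the bracket is a finite sum of products of coefficients of \<pi> with
  derivatives of the joint functions in the directions \<open>(0, b)\<close>, and each factor is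
  smooth in parameter and point together.\<close>

lemma smooth_family_pbr:
  assumes "smooth_on \<Omega> (case_prod F)" "smooth_on \<Omega> (case_prod G)"
  shows "smooth_on \<Omega> (case_prod (\<lambda>p. pbr \<pi> (F p) (G p)))"
proof (rule smooth_on_cong[OF open_\<Omega>])
  let ?P = "\<lambda>b c y. \<pi> (snd y) (blinfun_inner_left b) (blinfun_inner_left c)"
  show "smooth_on \<Omega> (\<lambda>y. \<Sum>b\<in>Basis. \<Sum>c\<in>Basis. ?P b c y *
      frechet_derivative (case_prod F) (at y) (0, b) *
      frechet_derivative (case_prod G) (at y) (0, c))"
    using smooth_family_bivector
    by (intro smooth_on_sum smooth_on_mult open_\<Omega> finite_Basis smooth_on_frechet_derivative assms)
      (simp add: case_prod_unfold)
qed (use pbr_family_expand[OF assms] in auto)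

lemma smooth_pbr:
  assumes "smooth_on O' f" "smooth_on O' g"
  shows "smooth_on O' (pbr \<pi> f g)"
proof -
  note C = smooth_family_const[OF open_O, where 'p = real]
  show ?thesis
    using smooth_family_partial(1)[OF open_O smooth_family_pbr[OF C C]] assms by simp
qed

lemma frechet_derivative_bivector:
  assumes "x \<in> O'"
  shows "frechet_derivative (\<lambda>y. \<pi> y \<alpha> \<beta>) (at x) v = (\<Sum>b\<in>Basis. \<Sum>c\<in>Basis.
    frechet_derivative (\<lambda>y. \<pi> y (blinfun_inner_left b) (blinfun_inner_left c)) (at x) v *
      blinfun_apply \<alpha> b * blinfun_apply \<beta> c)"
proof -
  let ?P = "\<lambda>b c y. \<pi> y (blinfun_inner_left b) (blinfun_inner_left c)"
  have d: "?P b c differentiable (at x)" for b c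
    by (rule smooth_on_differentiable[OF bivector_smooth assms])
  have d1: "(\<lambda>y. ?P b c y * r * s) differentiable (at x)" for b c and r s :: real
    using d by simp
  have "frechet_derivative (\<lambda>y. \<pi> y \<alpha> \<beta>) (at x) v = frechet_derivative (\<lambda>y. \<Sum>b\<in>Basis. \<Sum>c\<in>Basis.
      ?P b c y * blinfun_apply \<alpha> b * blinfun_apply \<beta> c) (at x) v"
    by (rule fun_cong[where x = v], rule frechet_derivative_cong_open[OF open_O assms],
        rule bivector_expand)
  also have "\<dots> = (\<Sum>b\<in>Basis. \<Sum>c\<in>Basis. frechet_derivative (\<lambda>y. ?P b c y *
      blinfun_apply \<alpha> b * blinfun_apply \<beta> c) (at x) v)"
    using d1 by (simp add: frechet_derivative_sum)
  finally show ?thesis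
    using d by (simp add: frechet_derivative_mult)
qed

text \<open>The product rule applied to the coordinate expansion: the derivative falls on \<pi> with
  frozen covectors, on \<open>F\<close>, or on \<open>G\<close>. As \<open>w\<close> is any
  direction in the product, this covers derivatives in the parameter, where \<open>snd w\<close> is
  0, as well as in the point.\<close>

lemma pbr_family_leibniz:
  fixes F G :: "'p::real_normed_vector \<Rightarrow> 'v \<Rightarrow> real"
  assumes F: "smooth_on \<Omega> (case_prod F)" and G: "smooth_on \<Omega> (case_prod G)" and x: "x \<in> O'"
  shows "frechet_derivative (case_prod (\<lambda>p. pbr \<pi> (F p) (G p))) (at (p, x)) w =
    frechet_derivative (\<lambda>y. \<pi> y (dfun (F p) x) (dfun (G p) x)) (at x) (snd w) +
    pbr \<pi> (\<lambda>x. frechet_derivative (case_prod F) (at (p, x)) w) (G p) x +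
    pbr \<pi> (F p) (\<lambda>x. frechet_derivative (case_prod G) (at (p, x)) w) x"
proof -
  let ?P = "\<lambda>b c y. \<pi> y (blinfun_inner_left b) (blinfun_inner_left c)"
  let ?F = "\<lambda>b y. frechet_derivative (case_prod F) (at y) (0, b)"
  let ?G = "\<lambda>b y. frechet_derivative (case_prod G) (at y) (0, b)"
  let ?z = "(p, x)"
  have z: "?z \<in> \<Omega>"
    using x by simp
  have d: "(\<lambda>y. ?P b c (snd y)) differentiable (at ?z)" "?F b differentiable (at ?z)"
    "?G b differentiable (at ?z)" for b c
    using smooth_on_differentiable[OF smooth_family_bivector z]
      smooth_on_differentiable[OF smooth_on_frechet_derivative[OF F] z]
      smooth_on_differentiable[OF smooth_on_frechet_derivative[OF G] z]
    by (auto simp: case_prod_unfold)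
  have DP: "frechet_derivative (\<lambda>y. ?P b c (snd y)) (at ?z) w =
    frechet_derivative (?P b c) (at x) (snd w)" for b c
    using frechet_derivative_affine(2)[where f = "?P b c" and x = ?z and v = w,
        OF _ bounded_linear_imp_has_derivative[OF bounded_linear_snd]]
      smooth_on_differentiable[OF bivector_smooth x]
    by (simp add: o_def)
  \<comment> \<open>By symmetry of second derivatives the derivative along \<open>w\<close> moves
    inside the one along \<open>(0, b)\<close>, so the coordinate terms reassemble into brackets of
    \<open>w\<close>-derivatives.\<close>
  have DF: "frechet_derivative (?F b) (at ?z) w =
      frechet_derivative (\<lambda>x. frechet_derivative (case_prod F) (at (p, x)) w) (at x) b" for b
    using frechet_derivative_commute[OF open_\<Omega> z F]
      smooth_family_partial(2)[OF open_O smooth_family_derivative[OF F] x]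
    by (simp add: case_prod_unfold)
  have DG: "frechet_derivative (?G b) (at ?z) w =
      frechet_derivative (\<lambda>x. frechet_derivative (case_prod G) (at (p, x)) w) (at x) b" for b
    using frechet_derivative_commute[OF open_\<Omega> z G]
      smooth_family_partial(2)[OF open_O smooth_family_derivative[OF G] x]
    by (simp add: case_prod_unfold)
  note F' = smooth_family_partial[OF open_O F] and G' = smooth_family_partial[OF open_O G]
  have dF: "F p differentiable (at x)" "G p differentiable (at x)"
    using smooth_on_differentiable F'(1) G'(1) x by blast+
  have dFw: "(\<lambda>x. frechet_derivative (case_prod F) (at (p, x)) w) differentiable (at x)"
    "(\<lambda>x. frechet_derivative (case_prod G) (at (p, x)) w) differentiable (at x)"
    using smooth_on_differentiable[OF smooth_family_partial(1)[OF open_O smooth_family_derivative] x] F G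
    by blast+
  have "frechet_derivative (case_prod (\<lambda>p. pbr \<pi> (F p) (G p))) (at ?z) w =
    frechet_derivative (\<lambda>y. \<Sum>b\<in>Basis. \<Sum>c\<in>Basis. ?P b c (snd y) * ?F b y * ?G c y) (at ?z) w"
    by (rule fun_cong[where x = w], rule frechet_derivative_cong_open[OF open_\<Omega> z])
      (use pbr_family_expand[OF F G] in auto)
  also have "\<dots> = (\<Sum>b\<in>Basis. \<Sum>c\<in>Basis. frechet_derivative (\<lambda>y. ?P b c (snd y) * ?F b y * ?G c y) (at ?z) w)"
    using d by (simp add: frechet_derivative_sum)
  also have "\<dots> = (\<Sum>b\<in>Basis. \<Sum>c\<in>Basis. frechet_derivative (?P b c) (at x) (snd w) * ?F b ?z * ?G c ?z +
      ?P b c x * frechet_derivative (?F b) (at ?z) w * ?G c ?z +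
      ?P b c x * ?F b ?z * frechet_derivative (?G c) (at ?z) w)"
    using d by (simp add: frechet_derivative_mult DP distrib_right)
  also have "\<dots> = frechet_derivative (\<lambda>y. \<pi> y (dfun (F p) x) (dfun (G p) x)) (at x) (snd w) +
    pbr \<pi> (\<lambda>x. frechet_derivative (case_prod F) (at (p, x)) w) (G p) x +
    pbr \<pi> (F p) (\<lambda>x. frechet_derivative (case_prod G) (at (p, x)) w) x"
    using x dF dFw
    by (simp add: sum.distrib frechet_derivative_bivector pbr_expand dfun_apply DF DG F'(2) G'(2))
  finally show ?thesis .
qed

text \<open>The family version for constant families, in the direction
  \<open>(0, v)\<close>.\<close>

lemma frechet_derivative_pbr:
  assumes "smooth_on O' f" "smooth_on O' g" "x \<in> O'"
  shows "frechet_derivative (pbr \<pi> f g) (at x) v =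
    frechet_derivative (\<lambda>y. \<pi> y (dfun f x) (dfun g x)) (at x) v +
    pbr \<pi> (\<lambda>x. frechet_derivative f (at x) v) g x +
    pbr \<pi> f (\<lambda>x. frechet_derivative g (at x) v) x"
proof -
  note C = smooth_family_const[OF open_O, where 'p = real]
  have D: "frechet_derivative (case_prod (\<lambda>p::real. h)) (at (0, x)) (0, v) = frechet_derivative h (at x) v"
    if "smooth_on O' h" "x \<in> O'" for h x
    using smooth_family_partial(2)[OF open_O C] that by simp
  have "frechet_derivative (pbr \<pi> f g) (at x) v =
      frechet_derivative (\<lambda>y. \<pi> y (dfun f x) (dfun g x)) (at x) v +
      pbr \<pi> (\<lambda>x. frechet_derivative (case_prod (\<lambda>p::real. f)) (at (0, x)) (0, v)) g x +
      pbr \<pi> f (\<lambda>x. frechet_derivative (case_prod (\<lambda>p::real. g)) (at (0, x)) (0, v)) x"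
    using pbr_family_leibniz[OF C C, of f g x 0 "(0, v)"] assms D[OF smooth_pbr] by simp
  moreover have "pbr \<pi> (\<lambda>x. frechet_derivative (case_prod (\<lambda>p::real. f)) (at (0, x)) (0, v)) g x =
      pbr \<pi> (\<lambda>x. frechet_derivative f (at x) v) g x"
    by (rule pbr_cong) (use D assms in auto)
  moreover have "pbr \<pi> f (\<lambda>x. frechet_derivative (case_prod (\<lambda>p::real. g)) (at (0, x)) (0, v)) x =
      pbr \<pi> f (\<lambda>x. frechet_derivative g (at x) v) x"
    by (rule pbr_cong) (use D assms in auto)
  ultimately show ?thesis
    by simp
qed

section \<open>The Jacobiator\<close>

text \<open>Bracketing with \<open>h\<close> is minus the derivative along its Hamiltonian vector,
  to which the Leibniz rule applies. That vector is frozen at \<open>x\<close>, so the second-order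
  terms are iterated directional derivatives in constant directions and are accessible to
  symmetry.\<close>

lemma pbr_pbr:
  assumes "smooth_on O' f" "smooth_on O' g" "smooth_on O' h" "x \<in> O'"
  shows "pbr \<pi> (pbr \<pi> f g) h x =
    frechet_derivative (\<lambda>y. frechet_derivative f (at y) (ham_vf \<pi> h x)) (at x) (ham_vf \<pi> g x) -
    frechet_derivative (\<lambda>y. frechet_derivative g (at y) (ham_vf \<pi> h x)) (at x) (ham_vf \<pi> f x) -
    frechet_derivative (\<lambda>y. \<pi> y (dfun f x) (dfun g x)) (at x) (ham_vf \<pi> h x)"
proof -
  let ?X = "ham_vf \<pi> h x"
  have d: "(\<lambda>y. frechet_derivative k (at y) ?X) differentiable (at x)" if "smooth_on O' k" for k
    using smooth_on_differentiable[OF smooth_on_frechet_derivative[OF that] assms(4)] .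
  have "pbr \<pi> (pbr \<pi> f g) h x = - frechet_derivative (pbr \<pi> f g) (at x) ?X"
    using pbr_antisym[OF assms(4), of _ h]
      pbr_ham_vf[OF assms(4) smooth_on_differentiable[OF smooth_pbr[OF assms(1,2)] assms(4)]] by simp
  also have "\<dots> = - frechet_derivative (\<lambda>y. \<pi> y (dfun f x) (dfun g x)) (at x) ?X
      + pbr \<pi> g (\<lambda>x. frechet_derivative f (at x) ?X) x - pbr \<pi> f (\<lambda>x. frechet_derivative g (at x) ?X) x"
    using frechet_derivative_pbr[OF assms(1,2,4)] pbr_antisym[OF assms(4), of _ g] by simp
  also have "\<dots> = - frechet_derivative (\<lambda>y. \<pi> y (dfun f x) (dfun g x)) (at x) ?X
      + frechet_derivative (\<lambda>y. frechet_derivative f (at y) ?X) (at x) (ham_vf \<pi> g x)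
      - frechet_derivative (\<lambda>y. frechet_derivative g (at y) ?X) (at x) (ham_vf \<pi> f x)"
    using pbr_ham_vf[OF assms(4) d] assms by simp
  finally show ?thesis
    by simp
qed

text \<open>By symmetry of second derivatives those of \<open>f\<close>, \<open>g\<close>, \<open>h\<close> cancel in the cyclic sum.\<close>

lemma Jac_tensorial:
  assumes "smooth_on O' f" "smooth_on O' g" "smooth_on O' h" "x \<in> O'"
  shows "Jac \<pi> f g h x = Jac \<pi> (blinfun_apply (dfun f x)) (blinfun_apply (dfun g x)) (blinfun_apply (dfun h x)) x"
proof -
  \<comment> \<open>What survives the cyclic sum: derivatives of \<pi> with frozen covectors, which
    see \<open>f\<close>, \<open>g\<close>, \<open>h\<close> only through their differentials at
    \<open>x\<close>.\<close>
  let ?K = "\<lambda>f g h. frechet_derivative (\<lambda>y. \<pi> y (dfun f x) (dfun g x)) (at x) (ham_vf \<pi> h x)"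
  have J: "Jac \<pi> f g h x = - ?K f g h - ?K g h f - ?K h f g"
    if "smooth_on O' f" "smooth_on O' g" "smooth_on O' h" for f g h
    using that assms(4) frechet_derivative_commute[OF open_O assms(4)]
    by (simp add: Jac_def pbr_pbr)
  have "ham_vf \<pi> (blinfun_apply (dfun h x)) x = ham_vf \<pi> h x" for h
    by (simp add: ham_vf_def dfun_blinfun_apply)
  then show ?thesis
    using assms by (simp add: J smooth_blinfun_apply dfun_blinfun_apply)
qed

lemma Jac_rotate: "Jac \<pi> f g h = Jac \<pi> g h f"
  by (simp add: Jac_def fun_eq_iff)

lemma Jac_cmult:
  assumes "smooth_on O' f" "smooth_on O' g" "smooth_on O' h" "x \<in> O'"
  shows "Jac \<pi> (\<lambda>y. c * f y) g h x = c * Jac \<pi> f g h x"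
proof -
  have s: "k differentiable (at y)" if "smooth_on O' k" "y \<in> O'" for k y
    using smooth_on_differentiable that .
  have "pbr \<pi> (pbr \<pi> (\<lambda>y. c * f y) g) h x = pbr \<pi> (\<lambda>y. c * pbr \<pi> f g y) h x"
    "pbr \<pi> (pbr \<pi> h (\<lambda>y. c * f y)) g x = pbr \<pi> (\<lambda>y. c * pbr \<pi> h f y) g x"
    using assms s by (auto intro!: pbr_cong pbr_cmult_left pbr_cmult_right)
  then show ?thesis
    using assms s smooth_pbr by (simp add: Jac_def pbr_cmult_left pbr_cmult_right distrib_left)
qed

lemma pbr_diff_left:
  assumes "x \<in> O'" "g differentiable (at x)" "h differentiable (at x)"
  shows "pbr \<pi> (\<lambda>y. g y - h y) f x = pbr \<pi> g f x - pbr \<pi> h f x"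
  using pbr_add_left[OF assms(1,2), of "\<lambda>y. - 1 * h y"] pbr_cmult_left[OF assms(1,3), of "- 1"] assms(3)
  by simp

lemma pbr_zero_left: "x \<in> O' \<Longrightarrow> pbr \<pi> (\<lambda>y. 0) f x = 0"
  using pbr_cmult_left[of x "\<lambda>y. 0" 0 f] by simp

lemma pbr_zero_right: "x \<in> O' \<Longrightarrow> pbr \<pi> f (\<lambda>y. 0) x = 0"
  using pbr_cmult_right[of x "\<lambda>y. 0" f 0] by simp

lemma Jac_cong:
  assumes "x \<in> O'" "\<And>y. y \<in> O' \<Longrightarrow> f y = f' y" "\<And>y. y \<in> O' \<Longrightarrow> g y = g' y"
    "\<And>y. y \<in> O' \<Longrightarrow> h y = h' y"
  shows "Jac \<pi> f g h x = Jac \<pi> f' g' h' x"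
proof -
  have "pbr \<pi> (pbr \<pi> f g) h x = pbr \<pi> (pbr \<pi> f' g') h' x"
    "pbr \<pi> (pbr \<pi> g h) f x = pbr \<pi> (pbr \<pi> g' h') f' x"
    "pbr \<pi> (pbr \<pi> h f) g x = pbr \<pi> (pbr \<pi> h' f') g' x"
    by (intro pbr_cong; use assms in simp)+
  then show ?thesis
    by (simp add: Jac_def)
qed

lemma smooth_family_Jac:
  assumes "smooth_on \<Omega> (case_prod F)" "smooth_on \<Omega> (case_prod G)" "smooth_on \<Omega> (case_prod H)"
  shows "smooth_on \<Omega> (case_prod (\<lambda>p. Jac \<pi> (F p) (G p) (H p)))"
  using smooth_on_add[OF open_\<Omega> smooth_on_add[OF open_\<Omega>
      smooth_family_pbr[OF smooth_family_pbr[OF assms(1,2)] assms(3)]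
      smooth_family_pbr[OF smooth_family_pbr[OF assms(2,3)] assms(1)]]
      smooth_family_pbr[OF smooth_family_pbr[OF assms(3,1)] assms(2)]]
  by (simp add: Jac_def case_prod_unfold)

lemma derivative_scaleR:
  assumes "smooth_on \<Omega> (case_prod F)" "x \<in> O'"
  shows "frechet_derivative (case_prod F) (at (p, x)) (c *\<^sub>R \<xi>, 0) =
    c * frechet_derivative (case_prod F) (at (p, x)) (\<xi>, 0)"
  using linear_frechet_derivative[OF smooth_on_differentiable[OF assms(1), of "(p, x)"]] assms(2)
    linear_cmul[of "frechet_derivative (case_prod F) (at (p, x))" c "(\<xi>, 0)"]
  by simp

end

section \<open>The Maurer--Cartan form\<close>

locale pre_poisson_form = pre_poisson O' \<pi>
  for O' :: "'v::euclidean_space set" and \<pi> +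
  fixes \<phi> :: "'v dual \<Rightarrow> 'v dual \<Rightarrow> 'v \<Rightarrow> real"
  assumes form: "form1 O' \<phi>"
begin

lemma smooth_form: "smooth_on \<Omega> (case_prod (\<lambda>\<xi>. \<phi> \<xi> \<zeta>))"
  using form by (auto simp: form1_def)

lemma form_add: "x \<in> O' \<Longrightarrow> \<phi> \<xi> (\<zeta> + \<eta>) x = \<phi> \<xi> \<zeta> x + \<phi> \<xi> \<eta> x"
  and form_scaleR: "x \<in> O' \<Longrightarrow> \<phi> \<xi> (c *\<^sub>R \<zeta>) x = c * \<phi> \<xi> \<zeta> x"
  using form unfolding form1_def linear_iff by auto

text \<open>The parameter derivative is taken of the joint function in direction
  \<open>(\<zeta>, 0)\<close>, so that it is again a smooth family and commutes with derivatives in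
  the point.\<close>

abbreviation D\<phi> :: "'v dual \<Rightarrow> 'v dual \<Rightarrow> 'v dual \<Rightarrow> 'v \<Rightarrow> real" where
  "D\<phi> \<zeta> \<eta> \<xi> x \<equiv> frechet_derivative (case_prod (\<lambda>\<xi>. \<phi> \<xi> \<eta>)) (at (\<xi>, x)) (\<zeta>, 0)"

lemma smooth_form_derivative: "smooth_on \<Omega> (case_prod (D\<phi> \<zeta> \<eta>))"
  by (rule smooth_family_derivative[OF smooth_form])

text \<open>By antisymmetry the two shuffles contribute equally, which absorbs the factor
  1/2.\<close>

lemma MC_eq:
  assumes "x \<in> O'"
  shows "MC \<pi> \<phi> \<xi> \<zeta> \<eta> x = D\<phi> \<zeta> \<eta> \<xi> x - D\<phi> \<eta> \<zeta> \<xi> x + pbr \<pi> (\<phi> \<xi> \<zeta>) (\<phi> \<xi> \<eta>) x"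
  using smooth_family_partial(4)[OF open_O smooth_form assms] pbr_antisym[OF assms, of "\<phi> \<xi> \<eta>" "\<phi> \<xi> \<zeta>"]
  by (simp add: MC_def dR1_def fbr11_def)

lemma smooth_MC: "smooth_on \<Omega> (case_prod (\<lambda>\<xi>. MC \<pi> \<phi> \<xi> \<zeta> \<eta>))"
  using MC_eq
  by (intro smooth_on_cong[OF open_\<Omega> smooth_on_add[OF open_\<Omega> smooth_on_diff[OF open_\<Omega>
          smooth_form_derivative smooth_form_derivative] smooth_family_pbr[OF smooth_form smooth_form]]])
    auto

lemma MC_antisym: "x \<in> O' \<Longrightarrow> MC \<pi> \<phi> \<xi> \<zeta> \<eta> x = - MC \<pi> \<phi> \<xi> \<eta> \<zeta> x"
  using pbr_antisym[of x "\<phi> \<xi> \<eta>" "\<phi> \<xi> \<zeta>"] by (simp add: MC_eq)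

text \<open>The form of linearity needed to polarize \<open>MC_ray\<close> along
  \<open>\<xi> + s *\<^sub>R \<zeta>\<close>.\<close>

lemma MC_add_scaleR:
  assumes x: "x \<in> O'"
  shows "MC \<pi> \<phi> \<xi> (\<zeta> + s *\<^sub>R \<zeta>') \<eta> x = MC \<pi> \<phi> \<xi> \<zeta> \<eta> x + s * MC \<pi> \<phi> \<xi> \<zeta>' \<eta> x"
proof -
  let ?y = "(\<xi>, x)"
  have y: "?y \<in> \<Omega>"
    using x by simp
  have d: "case_prod (\<lambda>\<xi>. \<phi> \<xi> \<eta>) differentiable (at ?y)" for \<eta>
    by (rule smooth_on_differentiable[OF smooth_form y])
  have d': "\<phi> \<xi> \<eta> differentiable (at x)" for \<eta>
    using smooth_on_differentiable[OF smooth_family_partial(1)[OF open_O smooth_form] x] .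
  have "D\<phi> (\<zeta> + s *\<^sub>R \<zeta>') \<eta> \<xi> x = D\<phi> \<zeta> \<eta> \<xi> x + s * D\<phi> \<zeta>' \<eta> \<xi> x"
    using linear_frechet_derivative[OF d[of \<eta>]]
      linear_add[of "frechet_derivative (case_prod (\<lambda>\<xi>. \<phi> \<xi> \<eta>)) (at ?y)" "(\<zeta>, 0)" "(s *\<^sub>R \<zeta>', 0)"]
    by (simp add: derivative_scaleR[OF smooth_form x])
  moreover have "D\<phi> \<eta> (\<zeta> + s *\<^sub>R \<zeta>') \<xi> x = D\<phi> \<eta> \<zeta> \<xi> x + s * D\<phi> \<eta> \<zeta>' \<xi> x"
  proof -
    have "frechet_derivative (case_prod (\<lambda>\<xi>. \<phi> \<xi> (\<zeta> + s *\<^sub>R \<zeta>'))) (at ?y) =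
      frechet_derivative (\<lambda>y. case_prod (\<lambda>\<xi>. \<phi> \<xi> \<zeta>) y + s * case_prod (\<lambda>\<xi>. \<phi> \<xi> \<zeta>') y) (at ?y)"
      by (rule frechet_derivative_cong_open[OF open_\<Omega> y]) (auto simp: form_add form_scaleR)
    then show ?thesis
      using d by (simp add: frechet_derivative_add frechet_derivative_cmult)
  qed
  moreover have "pbr \<pi> (\<phi> \<xi> (\<zeta> + s *\<^sub>R \<zeta>')) (\<phi> \<xi> \<eta>) x =
      pbr \<pi> (\<phi> \<xi> \<zeta>) (\<phi> \<xi> \<eta>) x + s * pbr \<pi> (\<phi> \<xi> \<zeta>') (\<phi> \<xi> \<eta>) x"
  proof -
    have "pbr \<pi> (\<phi> \<xi> (\<zeta> + s *\<^sub>R \<zeta>')) (\<phi> \<xi> \<eta>) x =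
      pbr \<pi> (\<lambda>y. \<phi> \<xi> \<zeta> y + s * \<phi> \<xi> \<zeta>' y) (\<phi> \<xi> \<eta>) x"
      by (rule pbr_cong[OF x]) (auto simp: form_add form_scaleR)
    then show ?thesis
      using d' x by (simp add: pbr_add_left pbr_cmult_left)
  qed
  ultimately show ?thesis
    by (simp add: MC_eq[OF x] algebra_simps)
qed

text \<open>The Bianchi identity: the \<open>d d \<phi>\<close> terms vanish, and replacing \<open>d \<phi>\<close> by
  \<open>MC - {\<phi>, \<phi>}/2\<close> in \<open>{d \<phi>, \<phi>}\<close> produces the Jacobiator.\<close>

lemma bianchi:
  fixes p :: "'v dual"
  assumes x: "x \<in> O'"
  defines "DMC \<equiv> \<lambda>X Y Z. frechet_derivative (case_prod (\<lambda>\<xi>. MC \<pi> \<phi> \<xi> Y Z)) (at (p, x)) (X, 0)"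
  shows "DMC X Y Z - DMC Y X Z + DMC Z X Y =
    pbr \<pi> (MC \<pi> \<phi> p X Y) (\<phi> p Z) x - pbr \<pi> (MC \<pi> \<phi> p X Z) (\<phi> p Y) x +
    pbr \<pi> (MC \<pi> \<phi> p Y Z) (\<phi> p X) x - Jac \<pi> (\<phi> p X) (\<phi> p Y) (\<phi> p Z) x"
proof -
  let ?y = "(p, x)"
  have y: "?y \<in> \<Omega>"
    using x by simp
  let ?DD = "\<lambda>X Y Z. frechet_derivative (case_prod (D\<phi> Y Z)) (at ?y) (X, 0)"
  \<comment> \<open>This symmetry is what makes the \<open>d d \<phi>\<close> terms cancel.\<close>
  have DD: "?DD A B C = ?DD B A C" for A B C
    using frechet_derivative_commute[OF open_\<Omega> y smooth_form, of C "(B, 0)" "(A, 0)"]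
    by (simp add: case_prod_unfold)
  have DD': "?DD X Y Z = ?DD Y X Z" "?DD X Z Y = ?DD Z X Y" "?DD Y Z X = ?DD Z Y X"
    by (rule DD)+
  have pd: "pbr \<pi> (\<lambda>x. D\<phi> X Y p x - D\<phi> Y X p x + pbr \<pi> (\<phi> p X) (\<phi> p Y) x) f x =
    pbr \<pi> (D\<phi> X Y p) f x - pbr \<pi> (D\<phi> Y X p) f x + pbr \<pi> (pbr \<pi> (\<phi> p X) (\<phi> p Y)) f x" for X Y f
    using smooth_on_differentiable[OF smooth_family_partial(1)[OF open_O smooth_form_derivative] x]
      smooth_on_differentiable[OF smooth_family_partial(1)[OF open_O
          smooth_family_pbr[OF smooth_form smooth_form]] x] x
    by (simp add: pbr_add_left pbr_diff_left)
  have DMC: "DMC X Y Z = ?DD X Y Z - ?DD X Z Y + pbr \<pi> (D\<phi> X Y p) (\<phi> p Z) x + pbr \<pi> (\<phi> p Y) (D\<phi> X Z p) x"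
    for X Y Z
  proof -
    have d: "case_prod (D\<phi> Y Z) differentiable (at ?y)"
      "case_prod (\<lambda>\<xi>. pbr \<pi> (\<phi> \<xi> Y) (\<phi> \<xi> Z)) differentiable (at ?y)" for Y Z
      using smooth_on_differentiable[OF smooth_form_derivative y]
        smooth_on_differentiable[OF smooth_family_pbr[OF smooth_form smooth_form] y] by blast+
    have "DMC X Y Z = frechet_derivative (\<lambda>z. case_prod (D\<phi> Y Z) z + - 1 * case_prod (D\<phi> Z Y) z +
        case_prod (\<lambda>\<xi>. pbr \<pi> (\<phi> \<xi> Y) (\<phi> \<xi> Z)) z) (at ?y) (X, 0)"
      unfolding DMC_def
      by (rule fun_cong[where x = "(X, 0)"], rule frechet_derivative_cong_open[OF open_\<Omega> y])
        (auto simp: MC_eq)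
    also have "\<dots> = ?DD X Y Z - ?DD X Z Y +
        frechet_derivative (case_prod (\<lambda>\<xi>. pbr \<pi> (\<phi> \<xi> Y) (\<phi> \<xi> Z))) (at ?y) (X, 0)"
    proof -
      have "frechet_derivative (\<lambda>z. a z + - 1 * b z + c z) (at z) v =
          frechet_derivative a (at z) v - frechet_derivative b (at z) v + frechet_derivative c (at z) v"
        if "a differentiable (at z)" "b differentiable (at z)" "c differentiable (at z)"
        for a b c :: "'v dual \<times> 'v \<Rightarrow> real" and z v
        by (rule frechet_derivative_eqI)
          (use that in \<open>auto simp: frechet_derivative_works intro!: derivative_eq_intros\<close>)
      from this[OF d(1) d(1) d(2)] show ?thesis .
    qed
    \<comment> \<open>The direction \<open>(X, 0)\<close> does not move the point, so the Leibniz
      term that differentiates \<pi> is zero.\<close>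
    also have "\<dots> = ?DD X Y Z - ?DD X Z Y + pbr \<pi> (D\<phi> X Y p) (\<phi> p Z) x + pbr \<pi> (\<phi> p Y) (D\<phi> X Z p) x"
      using pbr_family_leibniz[OF smooth_form smooth_form x]
        linear_0[OF linear_frechet_derivative[OF smooth_on_differentiable[OF bivector_smooth x]]]
      by simp
    finally show ?thesis .
  qed
  have MCp: "pbr \<pi> (MC \<pi> \<phi> p X Y) f x =
    pbr \<pi> (D\<phi> X Y p) f x - pbr \<pi> (D\<phi> Y X p) f x + pbr \<pi> (pbr \<pi> (\<phi> p X) (\<phi> p Y)) f x" for X Y f
    unfolding pd[symmetric] by (rule pbr_cong[OF x]) (auto simp: MC_eq)
  \<comment> \<open>The term with \<open>MC \<pi> \<phi> p X Z\<close> has its inner bracket in the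
    order opposite to the cyclic one in \<open>Jac\<close>; the swap gives the sign.\<close>
  have "pbr \<pi> (pbr \<pi> (\<phi> p X) (\<phi> p Z)) (\<phi> p Y) x =
    pbr \<pi> (\<lambda>y. - 1 * pbr \<pi> (\<phi> p Z) (\<phi> p X) y) (\<phi> p Y) x"
    by (rule pbr_cong[OF x]) (use pbr_antisym[of _ "\<phi> p X" "\<phi> p Z"] in simp_all)
  also have "\<dots> = - pbr \<pi> (pbr \<pi> (\<phi> p Z) (\<phi> p X)) (\<phi> p Y) x"
    using pbr_cmult_left[OF x smooth_on_differentiable[OF smooth_family_partial(1)[OF open_O
          smooth_family_pbr[OF smooth_form smooth_form]] x], where c = "- 1"]
    by simp
  finally have J: "pbr \<pi> (pbr \<pi> (\<phi> p X) (\<phi> p Z)) (\<phi> p Y) x = - pbr \<pi> (pbr \<pi> (\<phi> p Z) (\<phi> p X)) (\<phi> p Y) x" .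
  show ?thesis
    unfolding DMC MCp Jac_def J
    using DD'
      pbr_antisym[OF x, of "\<phi> p Y" "D\<phi> X Z p"] pbr_antisym[OF x, of "\<phi> p X" "D\<phi> Y Z p"]
      pbr_antisym[OF x, of "\<phi> p X" "D\<phi> Z Y p"]
    by linarith
qed

end

section \<open>The radial equations and their expansion at the origin\<close>

locale radial_maurer_cartan = pre_poisson_form O' \<pi> \<phi>
  for O' :: "'v::euclidean_space set" and \<pi> \<phi> +
  assumes MC_ray: "\<And>\<xi> \<zeta> x. x \<in> O' \<Longrightarrow> MC \<pi> \<phi> \<xi> \<xi> \<zeta> x = 0"
    and diag: "\<And>\<xi> x. x \<in> O' \<Longrightarrow> \<phi> \<xi> \<xi> x = blinfun_apply \<xi> x"
begin

text \<open>Polarizing \<open>diag\<close> evaluates the derivative of \<open>\<phi> p \<xi>\<close>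
  in \<open>p\<close> at \<xi> along \<zeta>; inserted into \<open>MC_ray\<close>, this leaves a
  transport equation for \<phi> along the ray through \<xi>.\<close>

lemma form_ray:
  assumes x: "x \<in> O'"
  shows "D\<phi> \<xi> \<zeta> \<xi> x + \<phi> \<xi> \<zeta> x + pbr \<pi> (blinfun_apply \<xi>) (\<phi> \<xi> \<zeta>) x = blinfun_apply \<zeta> x"
proof -
  note P = smooth_family_partial[OF open_O smooth_form]
  have "D\<phi> \<zeta> \<xi> \<xi> x = frechet_derivative (\<lambda>p. \<phi> p \<xi> x) (at \<xi>) \<zeta>"
    using P(4)[OF x] by simp
  also have "\<dots> = - (\<phi> \<xi> \<zeta> x - blinfun_apply \<zeta> x)"
  proof (rule polarize_at_zero[where b = "\<lambda>p. \<phi> p \<zeta> x - blinfun_apply \<zeta> x" and c = "blinfun_apply \<xi> x"])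
    fix s
    \<comment> \<open>Linearity in the second slot expands \<open>diag\<close> at
      \<open>\<xi> + s *\<^sub>R \<zeta>\<close>; moving \<open>s * \<zeta> x\<close> to the left
      makes the right side constant in \<open>s\<close>.\<close>
    show "\<phi> (\<xi> + s *\<^sub>R \<zeta>) \<xi> x + s * (\<phi> (\<xi> + s *\<^sub>R \<zeta>) \<zeta> x - blinfun_apply \<zeta> x) = blinfun_apply \<xi> x"
      using diag[OF x, of "\<xi> + s *\<^sub>R \<zeta>"]
      by (simp add: form_add[OF x] form_scaleR[OF x] blinfun.add_left blinfun.scaleR_left algebra_simps)
  qed (use P(3)[OF x] smooth_on_isCont[OF P(3)[OF x]] in auto)
  finally have "D\<phi> \<zeta> \<xi> \<xi> x = blinfun_apply \<zeta> x - \<phi> \<xi> \<zeta> x"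
    by simp
  moreover have "pbr \<pi> (\<phi> \<xi> \<xi>) (\<phi> \<xi> \<zeta>) x = pbr \<pi> (blinfun_apply \<xi>) (\<phi> \<xi> \<zeta>) x"
    by (rule pbr_cong[OF x]) (auto simp: diag)
  ultimately show ?thesis
    using MC_ray[OF x, of \<xi> \<zeta>] by (simp add: MC_eq[OF x])
qed

lemma pbr_scaleR_left:
  assumes "x \<in> O'"
  shows "pbr \<pi> (blinfun_apply (c *\<^sub>R \<xi>)) f x = c * pbr \<pi> (blinfun_apply \<xi>) f x"
  using pbr_cmult_left[OF assms smooth_on_differentiable[OF smooth_blinfun_apply assms]]
  by (simp add: scaleR_blinfun.rep_eq)

text \<open>At \<xi> = 0 the derivative in \<open>form_ray\<close> is along the zero direction and
  the bracket is with the zero function, so both vanish.\<close>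

lemma form_zero: "x \<in> O' \<Longrightarrow> \<phi> 0 \<zeta> x = blinfun_apply \<zeta> x"
  using form_ray[where \<xi> = 0 and \<zeta> = \<zeta> and x = x] pbr_scaleR_left[of x 0 0]
    linear_0[OF linear_frechet_derivative[OF smooth_on_differentiable[OF smooth_form, of "(0, x)"]]]
  by (simp add: zero_prod_def)

text \<open>Along \<open>s *\<^sub>R \<xi>\<close> the equation \<open>form_ray\<close> has the
  shape required by \<open>polarize_at_zero\<close>, with a \<open>b\<close> that itself contains
  the derivative sought. Solving for that derivative produces the factor 2.\<close>

lemma form_derivative_zero:
  assumes x: "x \<in> O'"
  shows "2 * D\<phi> \<xi> \<zeta> 0 x = - pbr \<pi> (blinfun_apply \<xi>) (blinfun_apply \<zeta>) x"
proof -
  note P = smooth_family_partial[OF open_O smooth_form]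
  let ?b = "\<lambda>p. D\<phi> \<xi> \<zeta> p x + pbr \<pi> (blinfun_apply \<xi>) (\<phi> p \<zeta>) x"
  have "isCont ?b 0"
    using smooth_on_isCont[OF smooth_family_partial(3)[OF open_O smooth_form_derivative x]]
      smooth_on_isCont[OF smooth_family_partial(3)[OF open_O smooth_family_pbr[OF
            smooth_family_const[OF open_O smooth_blinfun_apply] smooth_form] x]]
    by (intro continuous_intros) auto
  moreover have "\<phi> (0 + s *\<^sub>R \<xi>) \<zeta> x + s * ?b (0 + s *\<^sub>R \<xi>) = blinfun_apply \<zeta> x" for s
    using form_ray[OF x, where \<xi> = "s *\<^sub>R \<xi>" and \<zeta> = \<zeta>] derivative_scaleR[OF smooth_form x]
    by (simp add: pbr_scaleR_left[OF x] algebra_simps)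
  ultimately have "frechet_derivative (\<lambda>p. \<phi> p \<zeta> x) (at 0) \<xi> = - ?b 0"
    using polarize_at_zero[OF P(3)[OF x]] by blast
  moreover have "pbr \<pi> (blinfun_apply \<xi>) (\<phi> 0 \<zeta>) x = pbr \<pi> (blinfun_apply \<xi>) (blinfun_apply \<zeta>) x"
    by (rule pbr_cong[OF x]) (auto simp: form_zero)
  ultimately show ?thesis
    using P(4)[OF x] by simp
qed

text \<open>Each of the two derivative terms at the origin contributes minus half of the bracket of
  \<zeta> and \<eta>, and together they cancel the bracket term.\<close>

lemma MC_zero:
  assumes x: "x \<in> O'"
  shows "MC \<pi> \<phi> 0 \<zeta> \<eta> x = 0"
proof -
  have "pbr \<pi> (\<phi> 0 \<zeta>) (\<phi> 0 \<eta>) x = pbr \<pi> (blinfun_apply \<zeta>) (blinfun_apply \<eta>) x"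
    by (rule pbr_cong[OF x]) (auto simp: form_zero)
  then show ?thesis
    using form_derivative_zero[OF x, of \<zeta> \<eta>] form_derivative_zero[OF x, of \<eta> \<zeta>]
      pbr_antisym[OF x, of "blinfun_apply \<eta>" "blinfun_apply \<zeta>"]
    by (simp add: MC_eq[OF x])
qed

text \<open>On the diagonal \<open>X = p = \<xi>\<close> the Bianchi identity becomes a transport equation along
  the ray through \<open>\<xi>\<close>; the factor 2 comes from differentiating \<open>MC_p(p, _) = 0\<close> in \<open>p\<close>.\<close>

lemma MC_transport:
  assumes x: "x \<in> O'"
  shows "frechet_derivative (case_prod (\<lambda>\<xi>. MC \<pi> \<phi> \<xi> \<zeta> \<eta>)) (at (\<xi>, x)) (\<xi>, 0) + 2 * MC \<pi> \<phi> \<xi> \<zeta> \<eta> x +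
    pbr \<pi> (blinfun_apply \<xi>) (MC \<pi> \<phi> \<xi> \<zeta> \<eta>) x = - Jac \<pi> (blinfun_apply \<xi>) (\<phi> \<xi> \<zeta>) (\<phi> \<xi> \<eta>) x"
proof -
  note P = smooth_family_partial[OF open_O smooth_MC]
  \<comment> \<open>Polarization of \<open>MC_ray\<close>; it is used for both derivative terms of
    the Bianchi identity that have \<xi> in a slot.\<close>
  have D: "frechet_derivative (case_prod (\<lambda>p. MC \<pi> \<phi> p \<xi> \<eta>)) (at (\<xi>, x)) (\<zeta>, 0) = - MC \<pi> \<phi> \<xi> \<zeta> \<eta> x" for \<zeta> \<eta>
  proof -
    have "MC \<pi> \<phi> (\<xi> + s *\<^sub>R \<zeta>) \<xi> \<eta> x + s * MC \<pi> \<phi> (\<xi> + s *\<^sub>R \<zeta>) \<zeta> \<eta> x = 0" for s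
      using MC_ray[OF x, of "\<xi> + s *\<^sub>R \<zeta>" \<eta>] by (simp add: MC_add_scaleR[OF x])
    then have "frechet_derivative (\<lambda>p. MC \<pi> \<phi> p \<xi> \<eta> x) (at \<xi>) \<zeta> = - MC \<pi> \<phi> \<xi> \<zeta> \<eta> x"
      using polarize_at_zero[OF P(3)[OF x] smooth_on_isCont[OF P(3)[OF x]]] by blast
    then show ?thesis
      using P(4)[OF x] by simp
  qed
  have z: "pbr \<pi> (MC \<pi> \<phi> \<xi> \<xi> \<zeta>) f x = 0" for \<zeta> f
  proof -
    have "pbr \<pi> (MC \<pi> \<phi> \<xi> \<xi> \<zeta>) f x = pbr \<pi> (\<lambda>y. 0) f x"
      by (rule pbr_cong[OF x]) (auto simp: MC_ray)
    then show ?thesis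
      by (simp add: pbr_zero_left[OF x])
  qed
  have "pbr \<pi> (MC \<pi> \<phi> \<xi> \<zeta> \<eta>) (\<phi> \<xi> \<xi>) x = pbr \<pi> (MC \<pi> \<phi> \<xi> \<zeta> \<eta>) (blinfun_apply \<xi>) x"
    "Jac \<pi> (\<phi> \<xi> \<xi>) (\<phi> \<xi> \<zeta>) (\<phi> \<xi> \<eta>) x = Jac \<pi> (blinfun_apply \<xi>) (\<phi> \<xi> \<zeta>) (\<phi> \<xi> \<eta>) x"
    by (auto intro!: pbr_cong Jac_cong x simp: diag)
  then show ?thesis
    using bianchi[OF x, where p = \<xi> and X = \<xi> and Y = \<zeta> and Z = \<eta>] MC_antisym[OF x, of \<xi> \<eta> \<zeta>]
      pbr_antisym[OF x, of "blinfun_apply \<xi>" "MC \<pi> \<phi> \<xi> \<zeta> \<eta>"]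
    by (simp add: D z)
qed

section \<open>Transport along rays and the two formulas\<close>

text \<open>\<open>MC_transport\<close> at \<open>t *\<^sub>R \<xi>\<close> with the scalars pulled
  out. Every term except the undifferentiated \<open>MC\<close> carries a factor \<open>t\<close>,
  which suits polarization at 0; nothing is divided by \<open>t\<close>, so \<open>t = 0\<close> is
  included.\<close>

lemma MC_transport_ray:
  assumes x: "x \<in> O'"
  shows "t * frechet_derivative (case_prod (\<lambda>\<xi>. MC \<pi> \<phi> \<xi> \<zeta> \<eta>)) (at (t *\<^sub>R \<xi>, x)) (\<xi>, 0) +
    2 * MC \<pi> \<phi> (t *\<^sub>R \<xi>) \<zeta> \<eta> x + t * pbr \<pi> (blinfun_apply \<xi>) (MC \<pi> \<phi> (t *\<^sub>R \<xi>) \<zeta> \<eta>) x =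
    - t * Jac \<pi> (blinfun_apply \<xi>) (\<phi> (t *\<^sub>R \<xi>) \<zeta>) (\<phi> (t *\<^sub>R \<xi>) \<eta>) x"
proof -
  note S = smooth_family_partial(1)[OF open_O smooth_form]
  have "Jac \<pi> (blinfun_apply (t *\<^sub>R \<xi>)) (\<phi> (t *\<^sub>R \<xi>) \<zeta>) (\<phi> (t *\<^sub>R \<xi>) \<eta>) x =
    t * Jac \<pi> (blinfun_apply \<xi>) (\<phi> (t *\<^sub>R \<xi>) \<zeta>) (\<phi> (t *\<^sub>R \<xi>) \<eta>) x"
    using Jac_cmult[OF smooth_blinfun_apply S S x] by (simp add: scaleR_blinfun.rep_eq)
  then show ?thesis
    using MC_transport[OF x, where \<xi> = "t *\<^sub>R \<xi>" and \<zeta> = \<zeta> and \<eta> = \<eta>] derivative_scaleR[OF smooth_MC x]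
    by (simp add: pbr_scaleR_left[OF x])
qed

text \<open>Halving the transport equation and polarizing at 0 gives
  \<open>d = - (d + j) / 2\<close> for the derivative \<open>d\<close> and the Jacobiator
  \<open>j\<close>, because the bracket term vanishes with \<open>MC\<close> at the origin. Hence
  the factor -3.\<close>

lemma Jac_eq_deriv_MC:
  assumes x: "x \<in> O'"
  shows "Jac \<pi> (blinfun_apply \<xi>) (blinfun_apply \<zeta>) (blinfun_apply \<eta>) x =
    - 3 * deriv (\<lambda>t. MC \<pi> \<phi> (t *\<^sub>R \<xi>) \<zeta> \<eta> x) 0"
proof -
  note P = smooth_family_partial[OF open_O smooth_MC]
  let ?D = "\<lambda>p. frechet_derivative (case_prod (\<lambda>\<xi>. MC \<pi> \<phi> \<xi> \<zeta> \<eta>)) (at (p, x)) (\<xi>, 0)"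
  let ?b = "\<lambda>p. (?D p + pbr \<pi> (blinfun_apply \<xi>) (MC \<pi> \<phi> p \<zeta> \<eta>) x +
    Jac \<pi> (blinfun_apply \<xi>) (\<phi> p \<zeta>) (\<phi> p \<eta>) x) / 2"
  note C = smooth_family_const[OF open_O smooth_blinfun_apply]
  have "isCont ?b 0"
    using smooth_on_isCont[OF smooth_family_partial(3)[OF open_O smooth_family_derivative[OF smooth_MC] x]]
      smooth_on_isCont[OF smooth_family_partial(3)[OF open_O smooth_family_pbr[OF C smooth_MC] x]]
      smooth_on_isCont[OF smooth_family_partial(3)[OF open_O smooth_family_Jac[OF C smooth_form smooth_form] x]]
    by (intro continuous_intros) auto
  moreover have "MC \<pi> \<phi> (0 + s *\<^sub>R \<xi>) \<zeta> \<eta> x + s * ?b (0 + s *\<^sub>R \<xi>) = 0" for s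
    using MC_transport_ray[OF x, where t = s and \<xi> = \<xi> and \<zeta> = \<zeta> and \<eta> = \<eta>] by (simp add: algebra_simps add_divide_distrib)
  ultimately have D: "frechet_derivative (\<lambda>p. MC \<pi> \<phi> p \<zeta> \<eta> x) (at 0) \<xi> = - ?b 0"
    using polarize_at_zero[OF P(3)[OF x]] by blast
  have "pbr \<pi> (blinfun_apply \<xi>) (MC \<pi> \<phi> 0 \<zeta> \<eta>) x = pbr \<pi> (blinfun_apply \<xi>) (\<lambda>y. 0) x"
    by (rule pbr_cong[OF x]) (auto simp: MC_zero)
  then have pbr0: "pbr \<pi> (blinfun_apply \<xi>) (MC \<pi> \<phi> 0 \<zeta> \<eta>) x = 0"
    by (simp add: pbr_zero_right[OF x])
  have Jac0: "Jac \<pi> (blinfun_apply \<xi>) (\<phi> 0 \<zeta>) (\<phi> 0 \<eta>) x =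
      Jac \<pi> (blinfun_apply \<xi>) (blinfun_apply \<zeta>) (blinfun_apply \<eta>) x"
    by (rule Jac_cong[OF x]) (auto simp: form_zero)
  have "deriv (\<lambda>t. MC \<pi> \<phi> (t *\<^sub>R \<xi>) \<zeta> \<eta> x) 0 =
      frechet_derivative (\<lambda>p. MC \<pi> \<phi> p \<zeta> \<eta> x) (at 0) \<xi>"
    using smooth_on_line_derivative[OF P(3)[OF x], of 0 0 \<xi>] by (simp add: DERIV_imp_deriv)
  then have "deriv (\<lambda>t. MC \<pi> \<phi> (t *\<^sub>R \<xi>) \<zeta> \<eta> x) 0 = ?D 0"
    using P(4)[OF x] by simp
  moreover have "?D 0 = - ((?D 0 + Jac \<pi> (blinfun_apply \<xi>) (blinfun_apply \<zeta>) (blinfun_apply \<eta>) x) / 2)"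
    using D unfolding P(4)[OF x] pbr0 Jac0 by simp
  moreover have "j = - 3 * d" if "d = - ((d + j) / 2)" for d j :: real
    using that by (simp add: field_simps)
  ultimately show ?thesis
    by simp
qed

text \<open>\<open>Jac_cmult\<close> pulls a scalar out of the first slot; cyclic rotation brings
  both scaled arguments there in turn.\<close>

lemma Jac_form_scaleR:
  assumes x: "x \<in> O'"
  shows "Jac \<pi> (blinfun_apply \<xi>) (\<phi> p (t *\<^sub>R \<zeta>)) (\<phi> p (t *\<^sub>R \<eta>)) x =
    t\<^sup>2 * Jac \<pi> (blinfun_apply \<xi>) (\<phi> p \<zeta>) (\<phi> p \<eta>) x"
proof -
  note S = smooth_family_partial(1)[OF open_O smooth_form, of p]
  note L = smooth_blinfun_apply[of O' \<xi>]
  have "Jac \<pi> (blinfun_apply \<xi>) (\<phi> p (t *\<^sub>R \<zeta>)) (\<phi> p (t *\<^sub>R \<eta>)) x =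
    Jac \<pi> (\<lambda>y. t * \<phi> p \<zeta> y) (\<lambda>y. t * \<phi> p \<eta> y) (blinfun_apply \<xi>) x"
    unfolding Jac_rotate[of "blinfun_apply \<xi>"] by (rule Jac_cong[OF x]) (auto simp: form_scaleR)
  also have "\<dots> = t * Jac \<pi> (\<lambda>y. t * \<phi> p \<eta> y) (blinfun_apply \<xi>) (\<phi> p \<zeta>) x"
    using Jac_cmult[OF S smooth_on_cmult[OF open_O S] L x] Jac_rotate by metis
  also have "\<dots> = t\<^sup>2 * Jac \<pi> (\<phi> p \<eta>) (blinfun_apply \<xi>) (\<phi> p \<zeta>) x"
    using Jac_cmult[OF S L S x] by (simp add: power2_eq_square)
  finally show ?thesis
    by (simp add: Jac_rotate[of "\<phi> p \<eta>"])
qed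

text \<open>Along the flow, \<open>t\<^sup>2 MC\<^sub>t\<^sub>\<xi>(\<zeta>, \<eta>)\<close> at time \<open>t - 1\<close> is a primitive of the integrand.\<close>

lemma MC_eq_integral_Jac:
  assumes x: "x \<in> O'" and \<gamma>: "flow_curve O' \<pi> (blinfun_apply \<xi>) x \<gamma>"
  shows "MC \<pi> \<phi> \<xi> \<zeta> \<eta> x = - integral {0..1} (\<lambda>t. Jac \<pi> (blinfun_apply \<xi>)
    (\<phi> (t *\<^sub>R \<xi>) (t *\<^sub>R \<zeta>)) (\<phi> (t *\<^sub>R \<xi>) (t *\<^sub>R \<eta>)) (\<gamma> (t - 1)))"
proof -
  let ?M = "case_prod (\<lambda>\<xi>. MC \<pi> \<phi> \<xi> \<zeta> \<eta>)"
  let ?c = "\<lambda>t. (t *\<^sub>R \<xi>, \<gamma> (t - 1))"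
  let ?J = "\<lambda>t. Jac \<pi> (blinfun_apply \<xi>) (\<phi> (t *\<^sub>R \<xi>) (t *\<^sub>R \<zeta>)) (\<phi> (t *\<^sub>R \<xi>) (t *\<^sub>R \<eta>)) (\<gamma> (t - 1))"
  note P = smooth_family_partial[OF open_O smooth_MC]
  have deriv: "((\<lambda>t. t\<^sup>2 * ?M (?c t)) has_vector_derivative - ?J t) (at t within {0..1})"
    if t: "t \<in> {0..1}" for t
  proof -
    let ?y = "\<gamma> (t - 1)" and ?X = "ham_vf \<pi> (blinfun_apply \<xi>) (\<gamma> (t - 1))"
    let ?D = "frechet_derivative ?M (at (t *\<^sub>R \<xi>, ?y))"
    have y: "?y \<in> O'" and d\<gamma>: "(\<gamma> has_vector_derivative ?X) (at (t - 1) within {-1..0})"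
      using \<gamma> t by (auto simp: flow_curve_def)
    have "((\<lambda>t. t - 1) has_vector_derivative 1) (at t within {0..1})"
      by (auto intro!: derivative_eq_intros)
    then have "((\<lambda>t. \<gamma> (t - 1)) has_vector_derivative ?X) (at t within {0..1})"
      using vector_diff_chain_within[of "\<lambda>t. t - 1" 1 t "{0..1}" \<gamma> ?X]
        has_vector_derivative_within_subset[OF d\<gamma>, of "(\<lambda>t. t - 1) ` {0..1}"]
      by (auto simp: o_def)
    \<comment> \<open>The curve moves in the parameter and along the flow at once. Its velocity
      \<open>(\<xi>, ?X)\<close> splits the derivative of \<open>MC\<close> into the parameter
      derivative and the bracket with \<xi>.\<close>
    then have c: "(?c has_vector_derivative (\<xi>, ?X)) (at t within {0..1})"
      by (intro has_vector_derivative_Pair) (auto intro!: derivative_eq_intros)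
    have z: "(t *\<^sub>R \<xi>, ?y) \<in> \<Omega>"
      using y by simp
    note dM = smooth_on_has_derivative[OF smooth_MC[where \<zeta> = \<zeta> and \<eta> = \<eta>] z]
    have "(?M \<circ> ?c has_vector_derivative ?D (\<xi>, ?X)) (at t within {0..1})"
      by (rule vector_derivative_diff_chain_within[OF c])
        (rule has_derivative_at_withinI[OF dM])
    then have "((\<lambda>t. ?M (?c t)) has_real_derivative ?D (\<xi>, ?X)) (at t within {0..1})"
      by (simp add: o_def has_real_derivative_iff_has_vector_derivative)
    then have "((\<lambda>t. t\<^sup>2 * ?M (?c t)) has_real_derivative t\<^sup>2 * ?D (\<xi>, ?X) + 2 * t * ?M (?c t)) (at t within {0..1})"
      by (auto intro!: derivative_eq_intros)
    moreover have "?D (\<xi>, ?X) = ?D (\<xi>, 0) + pbr \<pi> (blinfun_apply \<xi>) (MC \<pi> \<phi> (t *\<^sub>R \<xi>) \<zeta> \<eta>) ?y"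
    proof -
      have "?D (\<xi>, ?X) = ?D (\<xi>, 0) + ?D (0, ?X)"
        using linear_add[OF has_derivative_linear[OF dM], of "(\<xi>, 0)" "(0, ?X)"] by simp
      then show ?thesis
        using pbr_ham_vf[OF y smooth_on_differentiable[OF P(1) y]] P(2)[OF y] by simp
    qed
    \<comment> \<open>The transport equation times a further \<open>t\<close>: the left side becomes
      the derivative of \<open>t\<^sup>2 * ?M (?c t)\<close>, the right side the Jacobiator with two
      scaled arguments.\<close>
    moreover have "t * (t * ?D (\<xi>, 0) + 2 * ?M (?c t) + t * pbr \<pi> (blinfun_apply \<xi>) (MC \<pi> \<phi> (t *\<^sub>R \<xi>) \<zeta> \<eta>) ?y) = - ?J t"
      using MC_transport_ray[OF y, where t = t and \<xi> = \<xi> and \<zeta> = \<zeta> and \<eta> = \<eta>] Jac_form_scaleR[OF y, of \<xi> "t *\<^sub>R \<xi>" t \<zeta> \<eta>]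
      by (simp add: power2_eq_square)
    ultimately show ?thesis
      by (simp add: has_real_derivative_iff_has_vector_derivative power2_eq_square algebra_simps)
  qed
  \<comment> \<open>The weight removes the boundary term at 0, and at time 1 the curve is back at
    \<open>\<gamma> 0 = x\<close>.\<close>
  have "((\<lambda>t. - ?J t) has_integral 1\<^sup>2 * ?M (?c 1) - 0\<^sup>2 * ?M (?c 0)) {0..1}"
    by (rule fundamental_theorem_of_calculus) (use deriv in auto)
  moreover have "\<gamma> 0 = x"
    using \<gamma> by (simp add: flow_curve_def)
  ultimately have "((\<lambda>t. - ?J t) has_integral MC \<pi> \<phi> \<xi> \<zeta> \<eta> x) {0..1}"
    by simp
  from has_integral_neg[OF this] have "integral {0..1} ?J = - MC \<pi> \<phi> \<xi> \<zeta> \<eta> x"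
    by (simp add: integral_unique)
  then show ?thesis
    by simp
qed

end

text \<open>A Hamiltonian flow may leave \<open>O'\<close> before time -1. The integral formula, and
  with it the passage from a vanishing Jacobiator to a vanishing \<open>MC\<close>, is therefore
  stated at points that admit a \<open>flow_curve\<close>.\<close>

theorem theorem2p3:
  fixes O' :: "'v::euclidean_space set"
    and \<pi> :: "'v \<Rightarrow> 'v dual \<Rightarrow> 'v dual \<Rightarrow> real"
    and \<phi> :: "'v dual \<Rightarrow> 'v dual \<Rightarrow> 'v \<Rightarrow> real"
  assumes "open O'"
    and "bivector_field O' \<pi>"
    and "form1 O' \<phi>"
    and MC_ray: "\<And>\<xi> \<zeta> x. x \<in> O' \<Longrightarrow> MC \<pi> \<phi> \<xi> \<xi> \<zeta> x = 0"
    and diag: "\<And>\<xi> x. x \<in> O' \<Longrightarrow> \<phi> \<xi> \<xi> x = blinfun_apply \<xi> x"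
  shows "(\<forall>\<xi> \<zeta> \<eta>. \<forall>x\<in>O'. Jac \<pi> (blinfun_apply \<xi>) (blinfun_apply \<zeta>) (blinfun_apply \<eta>) x =
            - 3 * deriv (\<lambda>t. MC \<pi> \<phi> (t *\<^sub>R \<xi>) \<zeta> \<eta> x) 0)
    \<and> (\<forall>\<xi> \<zeta> \<eta> x \<gamma>. x \<in> O' \<longrightarrow> flow_curve O' \<pi> (blinfun_apply \<xi>) x \<gamma> \<longrightarrow>
          MC \<pi> \<phi> \<xi> \<zeta> \<eta> x =
            - integral {0..1} (\<lambda>t. Jac \<pi> (blinfun_apply \<xi>) (\<phi> (t *\<^sub>R \<xi>) (t *\<^sub>R \<zeta>))
                                   (\<phi> (t *\<^sub>R \<xi>) (t *\<^sub>R \<eta>)) (\<gamma> (t - 1))))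
    \<and> ((\<forall>\<xi> \<zeta> \<eta>. \<forall>x\<in>O'. MC \<pi> \<phi> \<xi> \<zeta> \<eta> x = 0) \<longrightarrow>
          (\<forall>f g h. smooth_on O' f \<and> smooth_on O' g \<and> smooth_on O' h \<longrightarrow>
             (\<forall>x\<in>O'. Jac \<pi> f g h x = 0)))
    \<and> ((\<forall>f g h. smooth_on O' f \<and> smooth_on O' g \<and> smooth_on O' h \<longrightarrow>
             (\<forall>x\<in>O'. Jac \<pi> f g h x = 0)) \<longrightarrow>
          (\<forall>\<xi> \<zeta> \<eta> x \<gamma>. x \<in> O' \<longrightarrow> flow_curve O' \<pi> (blinfun_apply \<xi>) x \<gamma> \<longrightarrow>
             MC \<pi> \<phi> \<xi> \<zeta> \<eta> x = 0))"
proof -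
  interpret radial_maurer_cartan O' \<pi> \<phi>
    by unfold_locales (use assms in auto)
  \<comment> \<open>Tensoriality reduces to linear functions, where the derivative formula
    differentiates the zero function.\<close>
  have "Jac \<pi> f g h x = 0"
    if "\<forall>\<xi> \<zeta> \<eta>. \<forall>x\<in>O'. MC \<pi> \<phi> \<xi> \<zeta> \<eta> x = 0"
      and "smooth_on O' f" "smooth_on O' g" "smooth_on O' h" "x \<in> O'" for f g h x
    using that by (simp add: Jac_tensorial Jac_eq_deriv_MC)
  moreover have "MC \<pi> \<phi> \<xi> \<zeta> \<eta> x = 0"
    if J: "\<forall>f g h. smooth_on O' f \<and> smooth_on O' g \<and> smooth_on O' h \<longrightarrow> (\<forall>x\<in>O'. Jac \<pi> f g h x = 0)"
      and x: "x \<in> O'" and \<gamma>: "flow_curve O' \<pi> (blinfun_apply \<xi>) x \<gamma>" for \<xi> \<zeta> \<eta> x \<gamma>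
  proof -
    have "integral {0..1} (\<lambda>t. Jac \<pi> (blinfun_apply \<xi>) (\<phi> (t *\<^sub>R \<xi>) (t *\<^sub>R \<zeta>))
        (\<phi> (t *\<^sub>R \<xi>) (t *\<^sub>R \<eta>)) (\<gamma> (t - 1))) = integral {0..1} (\<lambda>t::real. 0::real)"
    proof (rule integral_cong)
      \<comment> \<open>Only flow times \<open>t - 1\<close> between -1 and 0 occur, and there
        \<open>flow_curve\<close> keeps the curve in \<open>O'\<close>.\<close>
      fix t :: real assume "t \<in> {0..1}"
      then have "\<gamma> (t - 1) \<in> O'"
        using \<gamma> by (auto simp: flow_curve_def)
      then show "Jac \<pi> (blinfun_apply \<xi>) (\<phi> (t *\<^sub>R \<xi>) (t *\<^sub>R \<zeta>)) (\<phi> (t *\<^sub>R \<xi>) (t *\<^sub>R \<eta>)) (\<gamma> (t - 1)) = 0"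
        using J smooth_blinfun_apply smooth_family_partial(1)[OF open_O smooth_form] by blast
    qed
    then show ?thesis
      using MC_eq_integral_Jac[OF x \<gamma>] by simp
  qed
  ultimately show ?thesis
    using Jac_eq_deriv_MC MC_eq_integral_Jac by blast
qed

end
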